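(* Let $\Omega\subset\mathbb{C}^n$ be a bounded domain with an admissible weight $\mu\in L^1(\Omega)$. Then for every $p\in\Omega$ and all non-zero vectors $X,Y\in\mathbb{C}^n$, the bisectional curvature of the weighted Bergman metric $g_{\Omega,\mu}$ is given by $$ B_{g_{\Omega,\mu}}(p;X,Y)=2-\left(1-\frac{|\langle X,Y\rangle_{g_{\Omega,\mu}(p)}|^2}{|X|_{g_{\Omega,\mu}(p)}^2|Y|_{g_{\Omega,\mu}(p)}^2}\right)-\frac{I^1_{\Omega,\mu}(p;X)\,I^1_{\Omega,\mu}(p;Y)}{I^2_{\Omega,\mu}(p;X,Y)\,I^0_{\Omega,\mu}(p)}. $$
   Context: Let $d\lambda$ be Lebesgue measure on $\mathbb{C}^n$. A weight on $\Omega$ is a positive function $\mu=e^{-\varphi}$, identified with the measure $d\mu=e^{-\varphi}d\lambda$. Let $\mathcal{A}^2(\Omega,\mu)$ be the space of holomorphic functions $u$ on $\Omega$ with $\|u\|_{\Omega,\mu}^2:=\int_\Omega|u|^2d\mu<\infty$. The weight is admissible if for every compact $A\subset\Omega$ there is $C_A>0$ with $\sup_{z\in A}|u(z)|\le C_A\|u\|_{\Omega,\mu}$ for all $u\in\mathcal{A}^2(\Omega,\mu)$. Then $\mathcal{A}^2(\Omega,\mu)$ is a Hilbert space with reproducing kernel $K_{\Omega,\mu}(z,w)$ (the weighted Bergman kernel); write $K_{\Omega,\mu}(z)=K_{\Omega,\mu}(z,z)$. For bounded $\Omega$ and admissible $\mu\in L^1(\Omega)$ it is known that $K_{\Omega,\mu}(z)>0$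 and that the matrix $g_{j\overline{k}}(z)=\partial_j\partial_{\overline{k}}\log K_{\Omega,\mu}(z)$ is positive definite everywhere, where $\partial_j=\partial/\partial z_j$, $\partial_{\overline k}=\partial/\partial\overline{z_k}$. The weighted Bergman metric $g_{\Omega,\mu}$ is the Kähler metric $\langle X,Y\rangle_{g_{\Omega,\mu}}=\sum_{j,k}g_{j\overline k}X_j\overline{Y_k}$, $|X|_{g_{\Omega,\mu}}=\sqrt{\langle X,X\rangle_{g_{\Omega,\mu}}}$, where $X\in\mathbb{C}^n$ is identified with $\sum_jX_j\partial_j$. Curvature conventions for a Kähler metric $g$: $R_{i\overline{j}k\overline{l}}=-\partial_k\partial_{\overline{l}}g_{i\overline{j}}+\sum_{\alpha,\beta}g^{\alpha\overline{\beta}}\,\partial_kg_{i\overline{\beta}}\,\partial_{\overline{l}}g_{\alpha\overline{j}}$, with $(g^{\alpha\overline\beta})$ the inverse matrix, and $B_g(p;X,Y)=\big(\sum_{i,j,k,l}R_{i\overline{j}k\overline{l}}(p)X_i\overline{X_j}Y_k\overline{Y_l}\big)/(|X|_{g(p)}^2|Y|_{g(p)}^2)$. Minimum integrals, with $\partial_X=\sum_jX_j\partial_j$ and $u$ ranging over $\mathcal{A}^2(\Omega,\mu)$: $I^0_{\Omega,\mu}(p)=\inf\{\|u\|_{\Omega,\mu}^2: u(p)=1\}$; $I^1_{\Omega,\mu}(p;X)=\inf\{\|u\|_{\Omega,\mu}^2: u(p)=0,\ \partial_Xu(p)=1\}$; $I^2_{\Omega,\mu}(p;X,Y)=\inf\{\|u\|_{\Omega,\mu}^2: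 u(p)=0,\ du(p)=0,\ \partial_X\partial_Yu(p)=1\}$. *)

theory Defs
  imports "HOL-Analysis.Analysis"
begin

section \<open>Holomorphic functions and Wirtinger derivatives on \<open>\<complex>\<^sup>n\<close>\<close>

definition holomorphic_Cn :: "(complex^'n \<Rightarrow> complex) \<Rightarrow> (complex^'n) set \<Rightarrow> bool" where
  "holomorphic_Cn u \<Omega> \<longleftrightarrow>
     (\<forall>z\<in>\<Omega>. \<exists>D. (u has_derivative D) (at z) \<and> (\<forall>c v. D (c *s v) = c * D v))"

text \<open>With \<open>z\<^sub>j = x\<^sub>j + \<i> y\<^sub>j\<close>, the partial derivatives in \<open>x\<^sub>j\<close> and \<open>y\<^sub>j\<close> are the derivatives at
  \<open>v = 1\<close> and \<open>v = \<i>\<close> below.\<close>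

definition partial_real :: "'n \<Rightarrow> complex \<Rightarrow> (complex^'n \<Rightarrow> complex) \<Rightarrow> complex^'n \<Rightarrow> complex" where
  "partial_real j v f z = vector_derivative (\<lambda>t::real. f (z + t *\<^sub>R axis j v)) (at 0)"

definition partial_z :: "'n \<Rightarrow> (complex^'n \<Rightarrow> complex) \<Rightarrow> complex^'n \<Rightarrow> complex" where
  "partial_z j f z = (partial_real j 1 f z - \<i> * partial_real j \<i> f z) / 2"

definition partial_zbar :: "'n \<Rightarrow> (complex^'n \<Rightarrow> complex) \<Rightarrow> complex^'n \<Rightarrow> complex" where
  "partial_zbar j f z = (partial_real j 1 f z + \<i> * partial_real j \<i> f z) / 2"

definition partial_dir ::
  "complex^'n \<Rightarrow> (complex^'n \<Rightarrow> complex) \<Rightarrow> complex^'n \<Rightarrow> complex" where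
  "partial_dir X f z = (\<Sum>j\<in>UNIV. X $ j * partial_z j f z)"


section \<open>Weighted Bergman spaces\<close>

definition weight :: "(complex^'n) set \<Rightarrow> (complex^'n \<Rightarrow> real) \<Rightarrow> bool" where
  "weight \<Omega> \<mu> \<longleftrightarrow> (\<forall>z\<in>\<Omega>. 0 < \<mu> z) \<and> \<mu> \<in> borel_measurable (lebesgue_on \<Omega>)"

definition weight_measure ::
  "(complex^'n) set \<Rightarrow> (complex^'n \<Rightarrow> real) \<Rightarrow> (complex^'n) measure" where
  "weight_measure \<Omega> \<mu> = density (lebesgue_on \<Omega>) (\<lambda>z. ennreal (\<mu> z))"

text \<open>Elements of the space are total functions whose values off \<open>\<Omega>\<close> are irrelevant: for open
  \<open>\<Omega>\<close>, norms, and values and derivatives at points of \<open>\<Omega>\<close>, depend only on the restriction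
  to \<open>\<Omega>\<close>.\<close>

definition bergman_space ::
  "(complex^'n) set \<Rightarrow> (complex^'n \<Rightarrow> real) \<Rightarrow> (complex^'n \<Rightarrow> complex) set" where
  "bergman_space \<Omega> \<mu> =
     {u. holomorphic_Cn u \<Omega> \<and> integrable (weight_measure \<Omega> \<mu>) (\<lambda>z. (cmod (u z))\<^sup>2)}"

definition bergman_norm ::
  "(complex^'n) set \<Rightarrow> (complex^'n \<Rightarrow> real) \<Rightarrow> (complex^'n \<Rightarrow> complex) \<Rightarrow> real" where
  "bergman_norm \<Omega> \<mu> u = sqrt (LINT z|weight_measure \<Omega> \<mu>. (cmod (u z))\<^sup>2)"

definition admissible_weight :: "(complex^'n) set \<Rightarrow> (complex^'n \<Rightarrow> real) \<Rightarrow> bool" where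
  "admissible_weight \<Omega> \<mu> \<longleftrightarrow> weight \<Omega> \<mu> \<and>
     (\<forall>A. compact A \<and> A \<subseteq> \<Omega> \<longrightarrow>
        (\<exists>C>0. \<forall>u\<in>bergman_space \<Omega> \<mu>. \<forall>z\<in>A. cmod (u z) \<le> C * bergman_norm \<Omega> \<mu> u))"

definition is_reproducing_kernel ::
  "(complex^'n) set \<Rightarrow> (complex^'n \<Rightarrow> real) \<Rightarrow> (complex^'n \<Rightarrow> complex^'n \<Rightarrow> complex) \<Rightarrow> bool" where
  "is_reproducing_kernel \<Omega> \<mu> K \<longleftrightarrow>
     (\<forall>w\<in>\<Omega>. (\<lambda>z. K z w) \<in> bergman_space \<Omega> \<mu> \<and>
        (\<forall>u\<in>bergman_space \<Omega> \<mu>. u w = (LINT z|weight_measure \<Omega> \<mu>. u z * cnj (K z w))))"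

text \<open>For an admissible weight on an open set a reproducing kernel exists and its values on
  \<open>\<Omega> \<times> \<Omega>\<close> are uniquely determined; the choice only concerns values elsewhere.\<close>

definition bergman_kernel ::
  "(complex^'n) set \<Rightarrow> (complex^'n \<Rightarrow> real) \<Rightarrow> complex^'n \<Rightarrow> complex^'n \<Rightarrow> complex" where
  "bergman_kernel \<Omega> \<mu> = (SOME K. is_reproducing_kernel \<Omega> \<mu> K)"


section \<open>Curvature of Hermitian metrics\<close>

text \<open>A metric is a matrix-valued function \<open>g\<close> with \<open>g z $ j $ k\<close> the coefficient
  \<open>g\<^bsub>j k\<^esub>\<close>, the second index being the conjugated one.\<close>

definition metric_inner :: "complex^'n^'n \<Rightarrow> complex^'n \<Rightarrow> complex^'n \<Rightarrow> complex" where
  "metric_inner G X Y = (\<Sum>j\<in>UNIV. \<Sum>k\<in>UNIV. G $ j $ k * X $ j * cnj (Y $ k))"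

text \<open>\<open>metric_inner G X X\<close> is real when \<open>G\<close> is Hermitian.\<close>

definition metric_norm :: "complex^'n^'n \<Rightarrow> complex^'n \<Rightarrow> real" where
  "metric_norm G X = sqrt (Re (metric_inner G X X))"

text \<open>The inverse coefficients \<open>g\<^sup>\<alpha>\<^sup>\<beta>\<close>, with \<open>\<beta>\<close> the conjugated index, are those with
  \<open>\<Sum>\<beta>. g\<^bsub>\<gamma> \<beta>\<^esub> g\<^sup>\<alpha>\<^sup>\<beta> = \<delta>\<^bsub>\<gamma> \<alpha>\<^esub>\<close>; hence the entry of the inverse matrix in row \<open>\<beta>\<close> and
  column \<open>\<alpha>\<close>.\<close>

definition curvature_tensor ::
  "(complex^'n \<Rightarrow> complex^'n^'n) \<Rightarrow> complex^'n \<Rightarrow> 'n \<Rightarrow> 'n \<Rightarrow> 'n \<Rightarrow> 'n \<Rightarrow> complex" where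
  "curvature_tensor g p i j k l =
     - partial_z k (partial_zbar l (\<lambda>z. g z $ i $ j)) p
     + (\<Sum>\<alpha>\<in>UNIV. \<Sum>\<beta>\<in>UNIV. matrix_inv (g p) $ \<beta> $ \<alpha>
          * partial_z k (\<lambda>z. g z $ i $ \<beta>) p * partial_zbar l (\<lambda>z. g z $ \<alpha> $ j) p)"

definition bisectional_curvature ::
  "(complex^'n \<Rightarrow> complex^'n^'n) \<Rightarrow> complex^'n \<Rightarrow> complex^'n \<Rightarrow> complex^'n \<Rightarrow> complex" where
  "bisectional_curvature g p X Y =
     (\<Sum>i\<in>UNIV. \<Sum>j\<in>UNIV. \<Sum>k\<in>UNIV. \<Sum>l\<in>UNIV.
        curvature_tensor g p i j k l * X $ i * cnj (X $ j) * Y $ k * cnj (Y $ l))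
     / complex_of_real ((metric_norm (g p) X)\<^sup>2 * (metric_norm (g p) Y)\<^sup>2)"

text \<open>On the diagonal of \<open>\<Omega> \<times> \<Omega>\<close> the kernel is real, being the squared norm of
  \<open>\<lambda>z. K z w\<close>.\<close>

definition bergman_metric ::
  "(complex^'n) set \<Rightarrow> (complex^'n \<Rightarrow> real) \<Rightarrow> complex^'n \<Rightarrow> complex^'n^'n" where
  "bergman_metric \<Omega> \<mu> z =
     (\<chi> j k. partial_z j (partial_zbar k
        (\<lambda>w. complex_of_real (ln (Re (bergman_kernel \<Omega> \<mu> w w))))) z)"


section \<open>Minimum integrals\<close>

definition min_integral0 :: 
  "(complex^'n) set \<Rightarrow> (complex^'n \<Rightarrow> real) \<Rightarrow> complex^'n \<Rightarrow> real" where
  "min_integral0 \<Omega> \<mu> p = Inf {(bergman_norm \<Omega> \<mu> u)\<^sup>2 | u. u \<in> bergman_space \<Omega> \<mu> \<and> u p = 1}"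

definition min_integral1 ::
  "(complex^'n) set \<Rightarrow> (complex^'n \<Rightarrow> real) \<Rightarrow> complex^'n \<Rightarrow> complex^'n \<Rightarrow> real" where
  "min_integral1 \<Omega> \<mu> p X = Inf {(bergman_norm \<Omega> \<mu> u)\<^sup>2 | u.
     u \<in> bergman_space \<Omega> \<mu> \<and> u p = 0 \<and> partial_dir X u p = 1}"

definition min_integral2 ::
  "(complex^'n) set \<Rightarrow> (complex^'n \<Rightarrow> real) \<Rightarrow> complex^'n \<Rightarrow> complex^'n \<Rightarrow> complex^'n \<Rightarrow> real" where
  "min_integral2 \<Omega> \<mu> p X Y = Inf {(bergman_norm \<Omega> \<mu> u)\<^sup>2 | u.
     u \<in> bergman_space \<Omega> \<mu> \<and> u p = 0 \<and> (u has_derivative (\<lambda>_. 0)) (at p) \<and>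
     partial_dir X (partial_dir Y u) p = 1}"

end

theory Submission
  imports Defs "HOL-Complex_Analysis.Cauchy_Integral_Formula"
begin

text \<open>Let \<open>K\<^sub>p\<close> be the kernel function at \<open>p\<close> and \<open>\<phi> = K\<^sub>p / sqrt (K p p)\<close>, so that \<open>\<phi>\<close> is a unit vector and
  \<open>\<phi> \<noteq> 0\<close> near \<open>p\<close>. Dividing \<open>K z z\<close> by \<open>\<phi> z * cnj (\<phi> z)\<close> changes its logarithm by a pluriharmonic function,
  hence does not change the metric, and gives the Gram function of the functionals \<open>u \<mapsto> u z / \<phi> z\<close>. Its mixed
  derivatives are the inner products of the representers of the functionals \<open>u \<mapsto> \<partial>\<^sup>I (u / \<phi>) z\<close>, and at \<open>p\<close>
  its pure derivatives vanish because \<open>\<phi> / \<phi> = 1\<close>. With \<open>b\<^sub>X\<close> and \<open>a\<close> the representers of \<open>\<partial>\<^sub>X (u / \<phi>) p\<close>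
  and \<open>\<partial>\<^sub>Y \<partial>\<^sub>X (u / \<phi>) p\<close>, the metric at \<open>p\<close> is the Gram matrix of the \<open>b\<close>'s and the curvature in the directions
  \<open>X, Y\<close> is \<open>\<parallel>X\<parallel>\<^sup>2 \<parallel>Y\<parallel>\<^sup>2 + |\<langle>X, Y\<rangle>|\<^sup>2 - \<parallel>a'\<parallel>\<^sup>2\<close>, where \<open>a'\<close> is the part of \<open>a\<close> orthogonal to the \<open>b\<close>'s.
  The extremal problems are solved by multiples of \<open>\<phi>\<close>, \<open>b\<^sub>X\<close> and \<open>a'\<close>, so that the minimum integrals are
  \<open>1 / K p p\<close>, \<open>1 / (K p p * \<parallel>b\<^sub>X\<parallel>\<^sup>2)\<close> and \<open>1 / (K p p * \<parallel>a'\<parallel>\<^sup>2)\<close>.\<close>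

section \<open>Holomorphic functions of several variables\<close>

lemma norm_scalar_mult_vec: "norm (c *s v) = cmod c * norm v" for v :: "complex^'n"
proof -
  have "(\<Sum>i\<in>UNIV. (cmod c * cmod (v $ i))\<^sup>2) = (cmod c)\<^sup>2 * (\<Sum>i\<in>UNIV. (cmod (v $ i))\<^sup>2)"
    by (simp add: power_mult_distrib sum_distrib_left)
  then show ?thesis
    by (simp add: norm_vec_def L2_set_def norm_mult real_sqrt_mult)
qed

lemma bounded_linear_scalar_mult_vec: "bounded_linear (\<lambda>t. t *s v)" for v :: "complex^'n"
proof (rule bounded_linear_intro[where K = "norm v"])
  show "(x + y) *s v = x *s v + y *s v" for x y by (simp add: vec_eq_iff algebra_simps)
  show "(r *\<^sub>R x) *s v = r *\<^sub>R (x *s v)" for r x by (simp add: vec_eq_iff)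
  show "norm (x *s v) \<le> norm x * norm v" for x by (simp add: norm_scalar_mult_vec)
qed

text \<open>Defined through the real Frechet derivative, so that it is a total operator and can be
  iterated. On holomorphic functions it agrees with \<open>partial_dir\<close>, see
  \<open>partial_dir_holomorphic\<close>.\<close>

definition dir_deriv :: "complex^'n \<Rightarrow> (complex^'n \<Rightarrow> complex) \<Rightarrow> complex^'n \<Rightarrow> complex" where
  "dir_deriv v u z = frechet_derivative u (at z) v"

lemma dir_deriv_eqI: "(u has_derivative D) (at z) \<Longrightarrow> dir_deriv v u z = D v"
  unfolding dir_deriv_def using frechet_derivative_at[of u D z] by simp

lemma holomorphic_CnI:
  assumes "\<And>z. z \<in> S \<Longrightarrow> (u has_derivative D z) (at z)"
    and "\<And>z c v. z \<in> S \<Longrightarrow> D z (c *s v) = c * D z v"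
  shows "holomorphic_Cn u S"
  using assms unfolding holomorphic_Cn_def by blast

lemma holomorphic_Cn_subset: "holomorphic_Cn u S \<Longrightarrow> T \<subseteq> S \<Longrightarrow> holomorphic_Cn u T"
  unfolding holomorphic_Cn_def by blast

lemma holomorphic_Cn_has_derivative:
  assumes "holomorphic_Cn u S" "z \<in> S"
  shows "(u has_derivative (\<lambda>v. dir_deriv v u z)) (at z)"
proof -
  obtain D where "(u has_derivative D) (at z)" using assms unfolding holomorphic_Cn_def by blast
  then show ?thesis unfolding dir_deriv_def using frechet_derivative_at[of u D z] by simp
qed

lemma dir_deriv_scale: "holomorphic_Cn u S \<Longrightarrow> z \<in> S \<Longrightarrow> dir_deriv (c *s v) u z = c * dir_deriv v u z"
  unfolding holomorphic_Cn_def by (fastforce simp: dir_deriv_eqI)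

lemma dir_deriv_zero_dir: "holomorphic_Cn u S \<Longrightarrow> z \<in> S \<Longrightarrow> dir_deriv 0 u z = 0"
  using dir_deriv_scale[of u S z 0 0] by simp

lemma dir_deriv_sum_dir:
  assumes "holomorphic_Cn u S" "z \<in> S"
  shows "dir_deriv (\<Sum>i\<in>I. f i) u z = (\<Sum>i\<in>I. dir_deriv (f i) u z)"
  using linear_sum[OF has_derivative_linear[OF holomorphic_Cn_has_derivative[OF assms]]] by simp

lemma holomorphic_Cn_continuous_on: "holomorphic_Cn u S \<Longrightarrow> continuous_on S u"
  by (rule continuous_at_imp_continuous_on)
    (blast intro: has_derivative_continuous holomorphic_Cn_has_derivative)

lemma holomorphic_Cn_transform:
  assumes "holomorphic_Cn u S" "open S" "\<And>z. z \<in> S \<Longrightarrow> u z = w z"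
  shows "holomorphic_Cn w S"
  by (rule holomorphic_CnI[where D = "\<lambda>z v. dir_deriv v u z"])
    (use assms in \<open>auto intro!: has_derivative_transform_within_open[OF holomorphic_Cn_has_derivative] simp: dir_deriv_scale\<close>)

lemma dir_deriv_cong:
  assumes "holomorphic_Cn u S" "open S" "z \<in> S" "\<And>z. z \<in> S \<Longrightarrow> u z = w z"
  shows "dir_deriv v w z = dir_deriv v u z"
  by (rule dir_deriv_eqI[OF has_derivative_transform_within_open[OF holomorphic_Cn_has_derivative]])
    (use assms in auto)

lemma
  assumes "holomorphic_Cn f S" "holomorphic_Cn g S"
  shows holomorphic_Cn_add: "holomorphic_Cn (\<lambda>z. f z + g z) S"
    and dir_deriv_add: "z \<in> S \<Longrightarrow> dir_deriv v (\<lambda>z. f z + g z) z = dir_deriv v f z + dir_deriv v g z"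
    and holomorphic_Cn_diff: "holomorphic_Cn (\<lambda>z. f z - g z) S"
    and dir_deriv_diff: "z \<in> S \<Longrightarrow> dir_deriv v (\<lambda>z. f z - g z) z = dir_deriv v f z - dir_deriv v g z"
    and holomorphic_Cn_mult: "holomorphic_Cn (\<lambda>z. f z * g z) S"
    and dir_deriv_mult: "z \<in> S \<Longrightarrow> dir_deriv v (\<lambda>z. f z * g z) z = f z * dir_deriv v g z + dir_deriv v f z * g z"
proof -
  note D = holomorphic_Cn_has_derivative[OF assms(1)] holomorphic_Cn_has_derivative[OF assms(2)]
  have a: "((\<lambda>z. f z + g z) has_derivative (\<lambda>v. dir_deriv v f z + dir_deriv v g z)) (at z)" if "z \<in> S" for z
    using that by (intro has_derivative_add D)
  have d: "((\<lambda>z. f z - g z) has_derivative (\<lambda>v. dir_deriv v f z - dir_deriv v g z)) (at z)" if "z \<in> S" for z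
    using that by (intro has_derivative_diff D)
  have m: "((\<lambda>z. f z * g z) has_derivative (\<lambda>v. f z * dir_deriv v g z + dir_deriv v f z * g z)) (at z)"
    if "z \<in> S" for z using that by (intro has_derivative_mult D)
  show "holomorphic_Cn (\<lambda>z. f z + g z) S"
    by (rule holomorphic_CnI, erule a) (simp add: dir_deriv_scale[OF assms(1)] dir_deriv_scale[OF assms(2)] algebra_simps)
  show "holomorphic_Cn (\<lambda>z. f z - g z) S"
    by (rule holomorphic_CnI, erule d) (simp add: dir_deriv_scale[OF assms(1)] dir_deriv_scale[OF assms(2)] algebra_simps)
  show "holomorphic_Cn (\<lambda>z. f z * g z) S"
    by (rule holomorphic_CnI, erule m) (simp add: dir_deriv_scale[OF assms(1)] dir_deriv_scale[OF assms(2)] algebra_simps)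
  show "z \<in> S \<Longrightarrow> dir_deriv v (\<lambda>z. f z + g z) z = dir_deriv v f z + dir_deriv v g z"
    "z \<in> S \<Longrightarrow> dir_deriv v (\<lambda>z. f z - g z) z = dir_deriv v f z - dir_deriv v g z"
    "z \<in> S \<Longrightarrow> dir_deriv v (\<lambda>z. f z * g z) z = f z * dir_deriv v g z + dir_deriv v f z * g z"
    by (auto intro!: dir_deriv_eqI[OF a] dir_deriv_eqI[OF d] dir_deriv_eqI[OF m])
qed

lemma holomorphic_Cn_const: "holomorphic_Cn (\<lambda>z. c) S"
  by (rule holomorphic_CnI[where D = "\<lambda>_ _. 0"]) auto

lemma dir_deriv_const: "dir_deriv v (\<lambda>z. c) z = 0"
  by (rule dir_deriv_eqI) (rule has_derivative_const)

lemma
  assumes "holomorphic_Cn f S"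
  shows holomorphic_Cn_cmult: "holomorphic_Cn (\<lambda>z. c * f z) S"
    and dir_deriv_cmult: "z \<in> S \<Longrightarrow> dir_deriv v (\<lambda>z. c * f z) z = c * dir_deriv v f z"
  using holomorphic_Cn_mult[OF holomorphic_Cn_const assms, of c]
    dir_deriv_mult[OF holomorphic_Cn_const assms, of z v c] by (auto simp: dir_deriv_const)

lemma holomorphic_Cn_inverse:
  assumes "holomorphic_Cn f S" "\<And>z. z \<in> S \<Longrightarrow> f z \<noteq> 0"
  shows "holomorphic_Cn (\<lambda>z. inverse (f z)) S"
proof (rule holomorphic_CnI)
  show "((\<lambda>z. inverse (f z)) has_derivative (\<lambda>h. - (inverse (f z) * dir_deriv h f z * inverse (f z)))) (at z)"
    if "z \<in> S" for z
    using Deriv.has_derivative_inverse[OF assms(2) holomorphic_Cn_has_derivative[OF assms(1)]] that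
    by blast
qed (use assms in \<open>simp add: dir_deriv_scale algebra_simps\<close>)

lemma holomorphic_Cn_divide:
  assumes "holomorphic_Cn f S" "holomorphic_Cn g S" "\<And>z. z \<in> S \<Longrightarrow> g z \<noteq> 0"
  shows "holomorphic_Cn (\<lambda>z. f z / g z) S"
  unfolding divide_inverse using assms by (intro holomorphic_Cn_mult holomorphic_Cn_inverse)

lemma
  assumes "holomorphic_Cn u T" "\<And>z. z \<in> S \<Longrightarrow> z + a \<in> T"
  shows holomorphic_Cn_translate: "holomorphic_Cn (\<lambda>z. u (z + a)) S"
    and dir_deriv_translate: "z \<in> S \<Longrightarrow> dir_deriv v (\<lambda>z. u (z + a)) z = dir_deriv v u (z + a)"
proof -
  have D: "((\<lambda>z. u (z + a)) has_derivative (\<lambda>v. dir_deriv v u (z + a))) (at z)" if "z \<in> S" for z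
    by (rule has_derivative_compose[where g = u and f = "\<lambda>z. z + a"])
      (auto intro!: derivative_eq_intros holomorphic_Cn_has_derivative[OF assms(1)] assms(2) that)
  show "holomorphic_Cn (\<lambda>z. u (z + a)) S"
    by (rule holomorphic_CnI, erule D) (use assms in \<open>auto intro: dir_deriv_scale\<close>)
  show "z \<in> S \<Longrightarrow> dir_deriv v (\<lambda>z. u (z + a)) z = dir_deriv v u (z + a)" by (rule dir_deriv_eqI[OF D])
qed

text \<open>Complex homogeneity of the differential makes the restriction to a complex line complex
  differentiable. This opens the way to one-variable theory.\<close>

lemma holomorphic_Cn_line:
  assumes "holomorphic_Cn u S" "z + t *s v \<in> S"
  shows "((\<lambda>t. u (z + t *s v)) has_field_derivative dir_deriv v u (z + t *s v)) (at t)"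
proof -
  have 1: "((\<lambda>t. z + t *s v) has_derivative (\<lambda>h. h *s v)) (at t)"
    using bounded_linear.has_derivative[OF bounded_linear_scalar_mult_vec has_derivative_ident]
    by (auto intro!: derivative_eq_intros)
  have "((\<lambda>t. u (z + t *s v)) has_derivative (\<lambda>h. dir_deriv (h *s v) u (z + t *s v))) (at t)"
    using has_derivative_compose[OF 1 holomorphic_Cn_has_derivative[OF assms]] .
  moreover have "(\<lambda>h. dir_deriv (h *s v) u (z + t *s v)) = (*) (dir_deriv v u (z + t *s v))"
    using dir_deriv_scale[OF assms] by (auto simp: mult.commute)
  ultimately show ?thesis by (simp add: has_field_derivative_def)
qed

section \<open>Cauchy estimates along complex lines\<close>

lemma scalar_line_in_cball:
  fixes z :: "complex^'n"
  assumes "v \<noteq> 0" "r \<ge> 0" "t \<in> cball 0 (r / norm v)"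
  shows "z + t *s v \<in> cball z r"
  using assms by (simp add: dist_norm norm_scalar_mult_vec field_simps)

text \<open>For \<open>v \<noteq> 0\<close> the complex line through \<open>z\<close> in direction
  \<open>v\<close> meets the ball of radius \<open>r\<close> in a disc of radius
  \<open>r / norm v\<close>; the one-variable Cauchy inequality is applied there.\<close>

lemma Cauchy_estimate_dir_deriv:
  assumes u: "holomorphic_Cn u S" and S: "cball z r \<subseteq> S" and r: "r > 0"
    and B: "\<And>w. w \<in> cball z r \<Longrightarrow> cmod (u w) \<le> B"
  shows "cmod (dir_deriv v u z) \<le> B / r * norm v"
proof (cases "v = 0")
  case True
  have "z \<in> S" using S r by auto
  then show ?thesis using dir_deriv_zero_dir[OF u] True by simp
next
  case False
  define \<rho> where "\<rho> = r / norm v"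
  have \<rho>: "\<rho> > 0" using False r by (simp add: \<rho>_def)
  have "\<And>t. t \<in> cball 0 \<rho> \<Longrightarrow> z + t *s v \<in> cball z r"
    unfolding \<rho>_def using False r by (intro scalar_line_in_cball) auto
  then have in_S: "z + t *s v \<in> S" and in_cb: "z + t *s v \<in> cball z r" if "t \<in> cball 0 \<rho>" for t
    using S that by blast+
  have D: "((\<lambda>t. u (z + t *s v)) has_field_derivative dir_deriv v u (z + t *s v)) (at t)"
    if "t \<in> cball 0 \<rho>" for t
    by (rule holomorphic_Cn_line[OF u in_S[OF that]])
  have "cmod ((deriv ^^ 1) (\<lambda>t. u (z + t *s v)) 0) \<le> fact 1 * B / \<rho> ^ 1"
  proof (rule Cauchy_inequality)
    show "(\<lambda>t. u (z + t *s v)) holomorphic_on ball 0 \<rho>"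
      unfolding holomorphic_on_open[OF open_ball] using D by (metis ball_subset_cball subsetD)
    show "continuous_on (cball 0 \<rho>) (\<lambda>t. u (z + t *s v))"
      by (rule continuous_at_imp_continuous_on) (blast intro: D DERIV_isCont)
  qed (use \<rho> B in_cb in auto)
  moreover have "deriv (\<lambda>t. u (z + t *s v)) 0 = dir_deriv v u z"
    using D[of 0] \<rho> by (auto intro: DERIV_imp_deriv)
  ultimately show ?thesis using False by (simp add: \<rho>_def)
qed

text \<open>A closed disc of radius \<open>\<rho>\<close> centred in \<open>cball 0 \<rho>\<close>
  stays in \<open>cball 0 (2*\<rho>)\<close>, so the Cauchy inequality bounds the second derivative
  by \<open>2 * B / \<rho>\<^sup>2\<close> and Taylor's formula applies.\<close>

lemma holomorphic_quadratic_remainder: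
  assumes f: "f holomorphic_on T" and T: "open T" "cball 0 (2*\<rho>) \<subseteq> T" and \<rho>: "\<rho> > 0"
    and B: "\<And>t. t \<in> cball 0 (2*\<rho>) \<Longrightarrow> cmod (f t) \<le> B" and t: "t \<in> cball 0 \<rho>"
  shows "cmod (f t - f 0 - deriv f 0 * t) \<le> 2 * B / \<rho>\<^sup>2 * (cmod t)\<^sup>2"
proof -
  have sub: "cball s \<rho> \<subseteq> cball 0 (2*\<rho>)" if "s \<in> cball 0 \<rho>" for s :: complex
  proof
    fix x assume "x \<in> cball s \<rho>"
    then show "x \<in> cball 0 (2*\<rho>)"
      using that dist_triangle[of 0 x s] by (simp del: dist_0_norm)
  qed
  have "cmod ((deriv ^^ 0) f t - (\<Sum>i\<le>1. (deriv ^^ i) f 0 * (t - 0) ^ i / fact i))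
      \<le> (2 * B / \<rho>\<^sup>2) * cmod (t - 0) ^ Suc 1 / fact 1"
  proof (rule complex_Taylor[where S = "cball 0 \<rho>" and f = "\<lambda>i. (deriv ^^ i) f"])
    fix i :: nat and s :: complex assume s: "s \<in> cball 0 \<rho>"
    then have "s \<in> T" using sub[OF s] T \<rho> by auto
    moreover have "(deriv ^^ i) f holomorphic_on T"
      by (rule holomorphic_higher_deriv[OF f T(1)])
    ultimately show "((deriv ^^ i) f has_field_derivative (deriv ^^ Suc i) f s) (at s within cball 0 \<rho>)"
      using T(1) by (auto intro!: has_field_derivative_at_within[OF holomorphic_derivI])
  next
    fix s :: complex assume s: "s \<in> cball 0 \<rho>"
    have sT: "cball s \<rho> \<subseteq> T" using sub[OF s] T by auto
    have "cmod ((deriv ^^ 2) f s) \<le> fact 2 * B / \<rho> ^ 2"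
    proof (rule Cauchy_inequality)
      show "f holomorphic_on ball s \<rho>"
        by (rule holomorphic_on_subset[OF f]) (use sT in auto)
      show "continuous_on (cball s \<rho>) f"
        by (rule holomorphic_on_imp_continuous_on, rule holomorphic_on_subset[OF f sT])
      show "cmod (f x) \<le> B" if "cmod (s - x) = \<rho>" for x
        using sub[OF s] that by (intro B) (auto simp: dist_norm)
    qed fact
    then show "cmod ((deriv ^^ Suc 1) f s) \<le> 2 * B / \<rho>\<^sup>2" by (simp add: numeral_2_eq_2)
  qed (use t \<rho> in auto)
  then show ?thesis by (simp add: power2_eq_square algebra_simps)
qed

text \<open>The point is that the constant depends on \<open>u\<close> only through the bound
  \<open>B\<close>. This uniformity serves for difference quotients near a point and, in
  \<open>has_wirtinger_G\<close>, for a whole family of functions.\<close>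

lemma dir_deriv_quadratic_remainder:
  assumes u: "holomorphic_Cn u S" and S: "open S" "cball z (2*r) \<subseteq> S" and r: "r > 0"
    and B: "\<And>w. w \<in> cball z (2*r) \<Longrightarrow> cmod (u w) \<le> B"
    and t: "cmod t * norm v \<le> r"
  shows "cmod (u (z + t *s v) - u z - t * dir_deriv v u z) \<le> 2 * B / r\<^sup>2 * (norm v)\<^sup>2 * (cmod t)\<^sup>2"
proof (cases "v = 0")
  case True
  have "z \<in> S" using S r by auto
  then show ?thesis using dir_deriv_zero_dir[OF u] True by simp
next
  case False
  define \<rho> where "\<rho> = r / norm v"
  have \<rho>: "\<rho> > 0" using False r by (simp add: \<rho>_def)
  define T where "T = (\<lambda>t. z + t *s v) -` S"
  have cont: "continuous_on UNIV (\<lambda>t. z + t *s v)"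
    by (intro continuous_intros linear_continuous_on bounded_linear_scalar_mult_vec)
  have "open T" unfolding T_def using S(1) cont by (rule open_vimage)
  have in_cb: "z + t *s v \<in> cball z (2*r)" if "t \<in> cball 0 (2*\<rho>)" for t
    using that False r by (intro scalar_line_in_cball) (auto simp: \<rho>_def)
  have D: "((\<lambda>t. u (z + t *s v)) has_field_derivative dir_deriv v u (z + t *s v)) (at t)"
    if "t \<in> T" for t
    by (rule holomorphic_Cn_line[OF u]) (use that in \<open>simp add: T_def\<close>)
  have sub: "cball 0 (2*\<rho>) \<subseteq> T" unfolding T_def by (meson in_cb S(2) subsetD subsetI vimageI2)
  have "cmod (u (z + t *s v) - u (z + 0 *s v) - deriv (\<lambda>t. u (z + t *s v)) 0 * t)
      \<le> 2 * B / \<rho>\<^sup>2 * (cmod t)\<^sup>2"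
  proof (rule holomorphic_quadratic_remainder[of _ T])
    show "(\<lambda>t. u (z + t *s v)) holomorphic_on T"
      using D \<open>open T\<close> by (auto simp: holomorphic_on_open)
    show "t \<in> cball 0 \<rho>" using t False by (simp add: \<rho>_def field_simps)
  qed (use in_cb sub B \<open>open T\<close> \<rho> in auto)
  moreover have "0 \<in> T" using sub \<rho> by auto
  then have "deriv (\<lambda>t. u (z + t *s v)) 0 = dir_deriv v u z"
    using D[of 0] by (auto intro!: DERIV_imp_deriv)
  ultimately show ?thesis using False by (simp add: \<rho>_def power_divide algebra_simps)
qed

section \<open>Locally uniform limits and iterated directional derivatives\<close>

lemma holomorphic_Cn_limit_at:
  assumes f: "\<And>n. holomorphic_Cn (f n) S" and r: "r > 0" and S: "cball z0 r \<subseteq> S"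
    and lim: "uniform_limit (cball z0 r) f g sequentially"
  shows "(g has_derivative (\<lambda>h. lim (\<lambda>n. dir_deriv h (f n) z0))) (at z0)"
    and "(\<lambda>n. dir_deriv h (f n) z0) \<longlonglongrightarrow> lim (\<lambda>n. dir_deriv h (f n) z0)"
proof -
  define B where "B = ball z0 (r/2)"
  have sub: "cball x (r/2) \<subseteq> cball z0 r" if "x \<in> B" for x
  proof
    fix y assume "y \<in> cball x (r/2)"
    then show "y \<in> cball z0 r" using that dist_triangle[of z0 y x] by (simp add: B_def)
  qed
  \<comment> \<open>Weierstrass' argument: balls of radius \<open>r/2\<close> around points of
    \<open>B\<close> stay in \<open>cball z0 r\<close>, so a Cauchy estimate for
    \<open>f m - f n\<close> makes the derivatives uniformly Cauchy on \<open>B\<close>. The factor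
    \<open>r/4\<close> below, doubled by the triangle inequality, cancels this radius.\<close>
  have cauchy: "\<exists>N. \<forall>m\<ge>N. \<forall>n\<ge>N. \<forall>x\<in>B. \<forall>h. cmod (dir_deriv h (f m) x - dir_deriv h (f n) x) \<le> e * norm h"
    if "e > 0" for e
  proof -
    have "e * (r/4) > 0" using that r by simp
    then obtain N where N0: "\<And>n y. n \<ge> N \<Longrightarrow> y \<in> cball z0 r \<Longrightarrow> dist (f n y) (g y) < e * (r/4)"
      using uniform_limitD[OF lim, of "e * (r/4)"] unfolding eventually_sequentially by blast
    have N: "dist (f m y) (f n y) < e * (r/2)" if "m \<ge> N" "n \<ge> N" "y \<in> cball z0 r" for m n y
      using N0[OF that(1,3)] N0[OF that(2,3)] dist_triangle2[of "f m y" "f n y" "g y"] by argo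
    have "cmod (dir_deriv h (f m) x - dir_deriv h (f n) x) \<le> e * norm h" if "m \<ge> N" "n \<ge> N" "x \<in> B" for m n x h
    proof -
      have "x \<in> cball x (r/2)" using r by simp
      then have x: "x \<in> S" using sub[OF that(3)] S by blast
      have "cmod (dir_deriv h (\<lambda>z. f m z - f n z) x) \<le> (e * (r/2)) / (r/2) * norm h"
        using sub[OF that(3)] S N[OF that(1,2)] r
        by (intro Cauchy_estimate_dir_deriv[OF holomorphic_Cn_diff[OF f f]]) (auto simp: dist_norm less_imp_le subset_iff)
      then show ?thesis using r by (simp add: dir_deriv_diff[OF f f x])
    qed
    then show ?thesis by blast
  qed
  have tends: "(\<lambda>n. dir_deriv h (f n) x) \<longlonglongrightarrow> lim (\<lambda>n. dir_deriv h (f n) x)" if x: "x \<in> B" for x h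
  proof -
    have "Cauchy (\<lambda>n. dir_deriv h (f n) x)"
    proof (rule metric_CauchyI)
      fix e :: real assume e: "e > 0"
      have "e / (norm h + 1) > 0" using e by (simp add: add_nonneg_pos)
      from cauchy[OF this] obtain N where
        N: "\<And>m n. m \<ge> N \<Longrightarrow> n \<ge> N \<Longrightarrow> cmod (dir_deriv h (f m) x - dir_deriv h (f n) x) \<le> e / (norm h + 1) * norm h"
        using x by blast
      moreover have "norm h + 1 > 0" by (simp add: add_nonneg_pos)
      then have "e / (norm h + 1) * norm h < e" using e by (simp add: field_simps)
      ultimately show "\<exists>M. \<forall>m\<ge>M. \<forall>n\<ge>M. dist (dir_deriv h (f m) x) (dir_deriv h (f n) x) < e"
        unfolding dist_norm by (blast intro: order_le_less_trans)
    qed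
    then show ?thesis by (simp add: Cauchy_convergent_iff convergent_LIMSEQ_iff)
  qed
  have z0: "z0 \<in> B" using r by (simp add: B_def)
  show "(\<lambda>n. dir_deriv h (f n) z0) \<longlonglongrightarrow> lim (\<lambda>n. dir_deriv h (f n) z0)" by (rule tends[OF z0])
  have fg: "(\<lambda>n. f n x) \<longlonglongrightarrow> g x" if "x \<in> cball z0 r" for x
    by (rule tendsto_uniform_limitI[OF lim that])
  have B_cb: "B \<subseteq> cball z0 r" using r by (auto simp: B_def)
  have "\<exists>G. \<forall>x\<in>B. (\<lambda>n. f n x) \<longlonglongrightarrow> G x \<and>
      (G has_derivative (\<lambda>h. lim (\<lambda>n. dir_deriv h (f n) x))) (at x within B)"
  proof (rule has_derivative_sequence[where ?x0.0 = z0 and f' = "\<lambda>n x h. dir_deriv h (f n) x"])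
    show "convex B" by (simp add: B_def)
    show "(f n has_derivative (\<lambda>h. dir_deriv h (f n) x)) (at x within B)" if "x \<in> B" for n x
      by (rule has_derivative_at_withinI, rule holomorphic_Cn_has_derivative[OF f]) (use that B_cb S in blast)
    show "\<forall>\<^sub>F n in sequentially. \<forall>x\<in>B. \<forall>h. cmod (dir_deriv h (f n) x - lim (\<lambda>n. dir_deriv h (f n) x)) \<le> e * norm h"
      if "e > 0" for e
    proof -
      from cauchy[OF that] obtain N where
        N: "\<And>m n x h. m \<ge> N \<Longrightarrow> n \<ge> N \<Longrightarrow> x \<in> B \<Longrightarrow> cmod (dir_deriv h (f n) x - dir_deriv h (f m) x) \<le> e * norm h"
        by blast
      have "cmod (dir_deriv h (f n) x - lim (\<lambda>n. dir_deriv h (f n) x)) \<le> e * norm h" if "n \<ge> N" "x \<in> B" for n x h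
      proof (rule LIMSEQ_le_const2)
        show "(\<lambda>m. cmod (dir_deriv h (f n) x - dir_deriv h (f m) x)) \<longlonglongrightarrow> cmod (dir_deriv h (f n) x - lim (\<lambda>n. dir_deriv h (f n) x))"
          by (intro tendsto_intros tends that)
        show "\<exists>M. \<forall>m\<ge>M. cmod (dir_deriv h (f n) x - dir_deriv h (f m) x) \<le> e * norm h"
          using N that by blast
      qed
      then show ?thesis by (auto simp: eventually_sequentially)
    qed
    show "(\<lambda>n. f n z0) \<longlonglongrightarrow> g z0" using fg r by auto
  qed (rule z0)
  \<comment> \<open>\<open>has_derivative_sequence\<close> yields some limit function; uniqueness of
    limits identifies it with \<open>g\<close> on \<open>B\<close>.\<close>
  then obtain G where G: "\<And>x. x \<in> B \<Longrightarrow> (\<lambda>n. f n x) \<longlonglongrightarrow> G x"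
    "\<And>x. x \<in> B \<Longrightarrow> (G has_derivative (\<lambda>h. lim (\<lambda>n. dir_deriv h (f n) x))) (at x within B)" by blast
  have "G x = g x" if "x \<in> B" for x
    using G(1)[OF that] fg[of x] B_cb that LIMSEQ_unique by blast
  moreover have "(G has_derivative (\<lambda>h. lim (\<lambda>n. dir_deriv h (f n) z0))) (at z0)"
    using G(2)[OF z0] at_within_open[OF z0] by (simp add: B_def)
  ultimately show "(g has_derivative (\<lambda>h. lim (\<lambda>n. dir_deriv h (f n) z0))) (at z0)"
    using has_derivative_transform_within_open[of G _ z0 UNIV B g] z0 by (simp add: B_def)
qed

lemma
  assumes f: "\<And>n. holomorphic_Cn (f n) S"
    and lim: "\<And>z. z \<in> S \<Longrightarrow> \<exists>r>0. cball z r \<subseteq> S \<and> uniform_limit (cball z r) f g sequentially"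
  shows holomorphic_Cn_limit: "holomorphic_Cn g S"
    and dir_deriv_limit: "z \<in> S \<Longrightarrow> (\<lambda>n. dir_deriv v (f n) z) \<longlonglongrightarrow> dir_deriv v g z"
proof -
  have D: "(g has_derivative (\<lambda>h. lim (\<lambda>n. dir_deriv h (f n) z))) (at z)"
    and T: "(\<lambda>n. dir_deriv h (f n) z) \<longlonglongrightarrow> lim (\<lambda>n. dir_deriv h (f n) z)" if "z \<in> S" for z h
  proof -
    from lim[OF that] obtain r where "r > 0" "cball z r \<subseteq> S" "uniform_limit (cball z r) f g sequentially"
      by blast
    from holomorphic_Cn_limit_at[OF f this]
    show "(g has_derivative (\<lambda>h. lim (\<lambda>n. dir_deriv h (f n) z))) (at z)"
      "(\<lambda>n. dir_deriv h (f n) z) \<longlonglongrightarrow> lim (\<lambda>n. dir_deriv h (f n) z)" .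
  qed
  show "holomorphic_Cn g S"
  proof (rule holomorphic_CnI, erule D)
    fix z c v assume z: "z \<in> S"
    have "(\<lambda>n. dir_deriv (c *s v) (f n) z) \<longlonglongrightarrow> c * lim (\<lambda>n. dir_deriv v (f n) z)"
      unfolding dir_deriv_scale[OF f z] by (intro tendsto_intros T z)
    then show "lim (\<lambda>n. dir_deriv (c *s v) (f n) z) = c * lim (\<lambda>n. dir_deriv v (f n) z)" by (rule limI)
  qed
  show "z \<in> S \<Longrightarrow> (\<lambda>n. dir_deriv v (f n) z) \<longlonglongrightarrow> dir_deriv v g z"
    using T dir_deriv_eqI[OF D] by simp
qed

text \<open>The quadratic remainder, divided by \<open>t n\<close>, tends to zero uniformly on a
  small ball. This exhibits \<open>dir_deriv v u\<close> as a uniform limit of holomorphic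
  functions.\<close>

lemma dir_deriv_difference_quotient:
  assumes u: "holomorphic_Cn u S" and S: "open S" "z0 \<in> S"
  obtains R and t :: "nat \<Rightarrow> complex" where "R > 0" "ball z0 R \<subseteq> S" "t \<longlonglongrightarrow> 0" "\<And>n. t n \<noteq> 0"
    "\<And>n z. z \<in> ball z0 R \<Longrightarrow> z + t n *s v \<in> S"
    "uniform_limit (ball z0 R) (\<lambda>n z. (u (z + t n *s v) - u z) / t n) (dir_deriv v u) sequentially"
proof -
  obtain e where e: "e > 0" "cball z0 e \<subseteq> S"
    using S unfolding open_contains_cball by blast
  define R where "R = e / 4"
  have R: "R > 0" and cb: "cball z0 (4*R) \<subseteq> S" using e by (auto simp: R_def)
  \<comment> \<open>The scaling gives \<open>cmod (t n) * norm v \<le> R\<close> for every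
    \<open>n\<close>, so that all translates stay in \<open>S\<close>; adding 1 to
    \<open>norm v\<close> covers \<open>v = 0\<close>.\<close>
  define t :: "nat \<Rightarrow> complex" where "t n = of_real (R / (norm v + 1)) * inverse (of_nat (Suc n))" for n
  have v1: "norm v + 1 > 0" by (simp add: add_nonneg_pos)
  have t0: "t n \<noteq> 0" for n
    using R v1 unfolding t_def by (simp del: of_nat_Suc of_real_divide)
  have "(\<lambda>n. of_real (R / (norm v + 1)) * inverse (of_nat (Suc n)) :: complex) \<longlonglongrightarrow> of_real (R / (norm v + 1)) * 0"
    by (intro tendsto_intros LIMSEQ_Suc[OF lim_inverse_n])
  then have tlim: "t \<longlonglongrightarrow> 0" by (simp add: t_def[abs_def])
  have tv: "cmod (t n) * norm v \<le> R" for n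
  proof -
    have "cmod (t n) = R / (norm v + 1) * inverse (real (Suc n))"
      using R v1 unfolding t_def norm_mult norm_inverse norm_of_nat norm_of_real by simp
    also have "\<dots> \<le> R / (norm v + 1) * 1"
      using R v1 by (intro mult_left_mono) (auto simp: inverse_le_1_iff)
    finally have "cmod (t n) * norm v \<le> R / (norm v + 1) * norm v" by (intro mult_right_mono) auto
    also have "\<dots> \<le> R" using R v1 by (simp add: field_simps)
    finally show ?thesis .
  qed
  have "compact (u ` cball z0 (4*R))"
    by (intro compact_continuous_image continuous_on_subset[OF holomorphic_Cn_continuous_on[OF u] cb] compact_cball)
  then have "bounded (u ` cball z0 (4*R))" by (rule compact_imp_bounded)
  then obtain B where B: "\<And>w. w \<in> cball z0 (4*R) \<Longrightarrow> cmod (u w) \<le> B"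
    unfolding bounded_iff by blast
  have near: "cball z (2*R) \<subseteq> cball z0 (4*R)" if "z \<in> ball z0 R" for z
  proof
    fix y assume "y \<in> cball z (2*R)"
    then show "y \<in> cball z0 (4*R)" using that R dist_triangle[of z0 y z] by simp
  qed
  define C where "C = 2 * B / R\<^sup>2 * (norm v)\<^sup>2"
  have est: "cmod ((u (z + t n *s v) - u z) / t n - dir_deriv v u z) \<le> C * cmod (t n)" if z: "z \<in> ball z0 R" for z n
  proof -
    have "cmod (u (z + t n *s v) - u z - t n * dir_deriv v u z) \<le> 2 * B / R\<^sup>2 * (norm v)\<^sup>2 * (cmod (t n))\<^sup>2"
      using near[OF z] cb B by (intro dir_deriv_quadratic_remainder[OF u S(1) _ R] tv) auto
    moreover have "(u (z + t n *s v) - u z) / t n - dir_deriv v u z = (u (z + t n *s v) - u z - t n * dir_deriv v u z) / t n"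
      using t0[of n] by (simp add: field_simps)
    ultimately show ?thesis using t0[of n] by (simp add: C_def norm_divide divide_le_eq power2_eq_square mult_ac)
  qed
  have "(\<lambda>n. C * cmod (t n)) \<longlonglongrightarrow> C * cmod 0" by (intro tendsto_intros tlim)
  then have Clim: "(\<lambda>n. C * cmod (t n)) \<longlonglongrightarrow> 0" by simp
  show thesis
  proof (rule that[OF R _ tlim t0])
    have "ball z0 R \<subseteq> cball z0 (4*R)" using R by auto
    then show "ball z0 R \<subseteq> S" using cb by blast
    show "z + t n *s v \<in> S" if "z \<in> ball z0 R" for n z
    proof -
      have "dist z (z + t n *s v) \<le> 2 * R" using tv[of n] R by (simp add: dist_norm norm_scalar_mult_vec)
      then show ?thesis using near[OF that] cb by auto
    qed
    show "uniform_limit (ball z0 R) (\<lambda>n z. (u (z + t n *s v) - u z) / t n) (dir_deriv v u) sequentially"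
    proof (rule uniform_limitI)
      fix \<epsilon> :: real assume "\<epsilon> > 0"
      then have "\<forall>\<^sub>F n in sequentially. C * cmod (t n) < \<epsilon>" by (rule order_tendstoD(2)[OF Clim])
      then show "\<forall>\<^sub>F n in sequentially. \<forall>z\<in>ball z0 R. dist ((u (z + t n *s v) - u z) / t n) (dir_deriv v u z) < \<epsilon>"
      proof eventually_elim
        case (elim n)
        then show ?case unfolding dist_norm using est[of _ n] by (blast intro: order_le_less_trans)
      qed
    qed
  qed
qed

text \<open>Locally uniform limits of holomorphic functions are holomorphic, and the derivatives
  converge as well. The second claim, with one sequence serving all \<open>w\<close>, prepares the
  symmetry of second derivatives.\<close>

lemma
  assumes u: "holomorphic_Cn u S" and S: "open S"
  shows holomorphic_Cn_dir_deriv: "holomorphic_Cn (dir_deriv v u) S"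
    and dir_deriv_dir_deriv_difference_quotient: "z0 \<in> S \<Longrightarrow> \<exists>t::nat \<Rightarrow> complex. t \<longlonglongrightarrow> 0 \<and> (\<forall>n. t n \<noteq> 0) \<and>
      (\<forall>w. (\<lambda>n. (dir_deriv w u (z0 + t n *s v) - dir_deriv w u z0) / t n) \<longlonglongrightarrow> dir_deriv w (dir_deriv v u) z0)"
proof -
  have *: "\<exists>R>0. holomorphic_Cn (dir_deriv v u) (ball z0 R) \<and> (\<exists>t::nat \<Rightarrow> complex. t \<longlonglongrightarrow> 0 \<and> (\<forall>n. t n \<noteq> 0) \<and>
      (\<forall>w. (\<lambda>n. (dir_deriv w u (z0 + t n *s v) - dir_deriv w u z0) / t n) \<longlonglongrightarrow> dir_deriv w (dir_deriv v u) z0))"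
    if z0: "z0 \<in> S" for z0
  proof -
    obtain R and t :: "nat \<Rightarrow> complex" where R: "R > 0" "ball z0 R \<subseteq> S" and t: "t \<longlonglongrightarrow> 0" "\<And>n. t n \<noteq> 0"
      and in_S: "\<And>n z. z \<in> ball z0 R \<Longrightarrow> z + t n *s v \<in> S"
      and ul: "uniform_limit (ball z0 R) (\<lambda>n z. (u (z + t n *s v) - u z) / t n) (dir_deriv v u) sequentially"
      by (rule dir_deriv_difference_quotient[OF u S z0, where v = v]) (rule that; assumption)
    define q where "q n z = inverse (t n) * (u (z + t n *s v) - u z)" for n z
    have ul: "uniform_limit (ball z0 R) q (dir_deriv v u) sequentially"
      using ul by (simp add: q_def[abs_def] divide_inverse mult.commute)
    have tr: "holomorphic_Cn (\<lambda>z. u (z + t n *s v)) (ball z0 R)" for n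
      by (rule holomorphic_Cn_translate[OF u in_S])
    note uB = holomorphic_Cn_subset[OF u R(2)]
    have q: "holomorphic_Cn (q n) (ball z0 R)" for n
      unfolding q_def[abs_def] by (intro holomorphic_Cn_cmult holomorphic_Cn_diff tr uB)
    have lim: "\<exists>r>0. cball z r \<subseteq> ball z0 R \<and> uniform_limit (cball z r) q (dir_deriv v u) sequentially"
      if "z \<in> ball z0 R" for z
    proof -
      obtain r where "r > 0" "cball z r \<subseteq> ball z0 R"
        using open_contains_cball[of "ball z0 R"] \<open>z \<in> ball z0 R\<close> by blast
      then show ?thesis using uniform_limit_on_subset[OF ul] by blast
    qed
    have zB: "z0 \<in> ball z0 R" using R by simp
    have "dir_deriv w (q n) z0 = (dir_deriv w u (z0 + t n *s v) - dir_deriv w u z0) / t n" for n w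
    proof -
      have "dir_deriv w (q n) z0 = inverse (t n) * (dir_deriv w (\<lambda>z. u (z + t n *s v)) z0 - dir_deriv w u z0)"
        unfolding q_def[abs_def]
        using dir_deriv_cmult[OF holomorphic_Cn_diff[OF tr[of n] uB] zB, where c = "inverse (t n)" and v = w]
          dir_deriv_diff[OF tr[of n] uB zB, where v = w] by simp
      then show ?thesis using dir_deriv_translate[OF u in_S zB, of w n] by (simp add: divide_inverse mult.commute)
    qed
    then have "\<forall>w. (\<lambda>n. (dir_deriv w u (z0 + t n *s v) - dir_deriv w u z0) / t n) \<longlonglongrightarrow> dir_deriv w (dir_deriv v u) z0"
      using dir_deriv_limit[OF q lim zB] by simp
    then show ?thesis using holomorphic_Cn_limit[OF q lim] R(1) t by blast
  qed
  show "holomorphic_Cn (dir_deriv v u) S"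
    unfolding holomorphic_Cn_def
  proof
    fix z assume "z \<in> S"
    from *[OF this] obtain R where "R > 0" "holomorphic_Cn (dir_deriv v u) (ball z R)" by blast
    then show "\<exists>D. (dir_deriv v u has_derivative D) (at z) \<and> (\<forall>c w. D (c *s w) = c * D w)"
      unfolding holomorphic_Cn_def using centre_in_ball by blast
  qed
  show "z0 \<in> S \<Longrightarrow> \<exists>t::nat \<Rightarrow> complex. t \<longlonglongrightarrow> 0 \<and> (\<forall>n. t n \<noteq> 0) \<and>
      (\<forall>w. (\<lambda>n. (dir_deriv w u (z0 + t n *s v) - dir_deriv w u z0) / t n) \<longlonglongrightarrow> dir_deriv w (dir_deriv v u) z0)"
    using * by blast
qed

text \<open>The same difference quotients of \<open>dir_deriv w u\<close> along \<open>v\<close>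
  tend to one side by the preceding lemma and to the other by the definition of the
  derivative.\<close>

lemma dir_deriv_commute:
  assumes u: "holomorphic_Cn u S" and S: "open S" "z \<in> S"
  shows "dir_deriv w (dir_deriv v u) z = dir_deriv v (dir_deriv w u) z"
proof -
  obtain t :: "nat \<Rightarrow> complex" where t: "t \<longlonglongrightarrow> 0" "\<And>n. t n \<noteq> 0"
    and q: "(\<lambda>n. (dir_deriv w u (z + t n *s v) - dir_deriv w u z) / t n) \<longlonglongrightarrow> dir_deriv w (dir_deriv v u) z"
    using dir_deriv_dir_deriv_difference_quotient[OF u S] by blast
  have "((\<lambda>s. dir_deriv w u (z + s *s v)) has_field_derivative dir_deriv v (dir_deriv w u) z) (at 0)"
    using holomorphic_Cn_line[OF holomorphic_Cn_dir_deriv[OF u S(1)], of z 0 v w] S(2) by simp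
  then have "((\<lambda>s. (dir_deriv w u (z + s *s v) - dir_deriv w u z) / s) \<longlongrightarrow> dir_deriv v (dir_deriv w u) z) (at 0)"
    by (simp add: has_field_derivative_iff)
  moreover have "filterlim t (at 0) sequentially" using t by (simp add: filterlim_at)
  ultimately have "(\<lambda>n. (dir_deriv w u (z + t n *s v) - dir_deriv w u z) / t n) \<longlonglongrightarrow> dir_deriv v (dir_deriv w u) z"
    by (rule filterlim_compose)
  then show ?thesis using q LIMSEQ_unique by blast
qed

section \<open>The weighted Bergman space as a Hilbert space\<close>

locale weighted_domain =
  fixes \<Omega> :: "(complex^'n) set" and \<mu> :: "complex^'n \<Rightarrow> real"
  assumes open_domain: "open \<Omega>" and bounded_domain: "bounded \<Omega>"
    and admissible: "admissible_weight \<Omega> \<mu>" and integrable_weight: "integrable (lebesgue_on \<Omega>) \<mu>"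
begin

abbreviation "M \<equiv> weight_measure \<Omega> \<mu>"
abbreviation "H \<equiv> bergman_space \<Omega> \<mu>"
abbreviation "N \<equiv> bergman_norm \<Omega> \<mu>"

definition ip :: "(complex^'n \<Rightarrow> complex) \<Rightarrow> (complex^'n \<Rightarrow> complex) \<Rightarrow> complex" where
  "ip u v = (LINT z|M. u z * cnj (v z))"

lemma space_M: "space M = \<Omega>"
  by (simp add: weight_measure_def)

lemma holomorphic_measurable:
  assumes "holomorphic_Cn u \<Omega>" shows "u \<in> borel_measurable M"
proof -
  have "u \<in> borel_measurable (lebesgue_on \<Omega>)"
    by (rule continuous_imp_measurable_on_sets_lebesgue[OF holomorphic_Cn_continuous_on[OF assms]])
      (simp add: open_domain borel_open)
  then show ?thesis by (simp add: weight_measure_def)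
qed

lemma H_holomorphic: "u \<in> H \<Longrightarrow> holomorphic_Cn u \<Omega>"
  and H_integrable: "u \<in> H \<Longrightarrow> integrable M (\<lambda>z. (cmod (u z))\<^sup>2)"
  by (simp_all add: bergman_space_def)

lemma HI: "holomorphic_Cn u \<Omega> \<Longrightarrow> integrable M (\<lambda>z. (cmod (u z))\<^sup>2) \<Longrightarrow> u \<in> H"
  by (simp add: bergman_space_def)

lemma H_measurable: "u \<in> H \<Longrightarrow> u \<in> borel_measurable M"
  by (simp add: H_holomorphic holomorphic_measurable)

lemma H_add: assumes "u \<in> H" "v \<in> H" shows "(\<lambda>z. u z + v z) \<in> H"
proof (rule HI)
  show h: "holomorphic_Cn (\<lambda>z. u z + v z) \<Omega>"
    by (intro holomorphic_Cn_add H_holomorphic assms)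
  note [measurable] = H_measurable[OF assms(1)] H_measurable[OF assms(2)]
  have "integrable M (\<lambda>z. 2 * (cmod (u z))\<^sup>2 + 2 * (cmod (v z))\<^sup>2)"
    using assms by (intro Bochner_Integration.integrable_add integrable_mult_right H_integrable)
  then show "integrable M (\<lambda>z. (cmod (u z + v z))\<^sup>2)"
  proof (rule Bochner_Integration.integrable_bound)
    show "(\<lambda>z. (cmod (u z + v z))\<^sup>2) \<in> borel_measurable M" by measurable
    have "(cmod (u z + v z))\<^sup>2 \<le> 2 * (cmod (u z))\<^sup>2 + 2 * (cmod (v z))\<^sup>2" for z
    proof -
      have "(cmod (u z + v z))\<^sup>2 \<le> (cmod (u z) + cmod (v z))\<^sup>2"
        by (intro power_mono norm_triangle_ineq) auto
      also have "\<dots> \<le> 2 * (cmod (u z))\<^sup>2 + 2 * (cmod (v z))\<^sup>2"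
        using sum_squares_bound[of "cmod (u z)" "cmod (v z)"] by (simp add: power2_sum)
      finally show ?thesis .
    qed
    then show "AE z in M. norm ((cmod (u z + v z))\<^sup>2) \<le> norm (2 * (cmod (u z))\<^sup>2 + 2 * (cmod (v z))\<^sup>2)"
      by simp
  qed
qed

lemma H_cmult: assumes "u \<in> H" shows "(\<lambda>z. c * u z) \<in> H"
  using assms by (intro HI) (auto intro: holomorphic_Cn_cmult H_holomorphic H_integrable simp: norm_mult power_mult_distrib)

lemma H_diff: assumes "u \<in> H" "v \<in> H" shows "(\<lambda>z. u z - v z) \<in> H"
  using H_add[OF assms(1) H_cmult[OF assms(2), of "-1"]] by simp

lemma H_zero: "(\<lambda>z. 0) \<in> H"
  by (rule HI) (auto intro: holomorphic_Cn_const)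

lemma H_sum: assumes "\<And>i. i \<in> I \<Longrightarrow> f i \<in> H" shows "(\<lambda>z. \<Sum>i\<in>I. f i z) \<in> H"
  using assms by (induction I rule: infinite_finite_induct) (auto intro: H_zero H_add)

text \<open>Integrability of the weight makes \<open>M\<close> a finite measure. This is the source
  of concrete members of the space: constants, and polynomials through
  \<open>entire_in_H\<close>.\<close>

lemma H_bounded:
  assumes u: "holomorphic_Cn u \<Omega>" and b: "bounded (u ` \<Omega>)"
  shows "u \<in> H"
proof (rule HI[OF u])
  obtain B where B: "\<And>z. z \<in> \<Omega> \<Longrightarrow> cmod (u z) \<le> B" using b unfolding bounded_iff by blast
  note [measurable] = holomorphic_measurable[OF u]
  have pos: "AE z in lebesgue_on \<Omega>. 0 \<le> \<mu> z"
    by (rule AE_I2) (use admissible in \<open>simp add: admissible_weight_def weight_def less_imp_le\<close>)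
  have \<mu>: "\<mu> \<in> borel_measurable (lebesgue_on \<Omega>)"
    using admissible by (simp add: admissible_weight_def weight_def)
  have "integrable M (\<lambda>z. B\<^sup>2)"
    unfolding weight_measure_def
    by (subst integrable_density[OF _ \<mu> pos]) (auto intro: integrable_weight)
  then show "integrable M (\<lambda>z. (cmod (u z))\<^sup>2)"
  proof (rule Bochner_Integration.integrable_bound)
    show "AE z in M. norm ((cmod (u z))\<^sup>2) \<le> norm (B\<^sup>2)"
      using B by (intro AE_I2) (auto simp: space_M intro!: power_mono)
  qed measurable
qed

lemma integrable_ip:
  assumes "u \<in> H" "v \<in> H" shows "integrable M (\<lambda>z. u z * cnj (v z))"
proof (rule Bochner_Integration.integrable_bound)
  note [measurable] = H_measurable[OF assms(1)] H_measurable[OF assms(2)]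
  show "integrable M (\<lambda>z. (cmod (u z))\<^sup>2 + (cmod (v z))\<^sup>2)"
    using assms by (intro Bochner_Integration.integrable_add H_integrable)
  have "continuous_on UNIV cnj" by (intro continuous_intros)
  from borel_measurable_continuous_on[OF this H_measurable[OF assms(2)]]
  show "(\<lambda>z. u z * cnj (v z)) \<in> borel_measurable M" by measurable
  have "cmod (u z * cnj (v z)) \<le> (cmod (u z))\<^sup>2 + (cmod (v z))\<^sup>2" for z
  proof -
    have "2 * (cmod (u z) * cmod (v z)) \<le> (cmod (u z))\<^sup>2 + (cmod (v z))\<^sup>2"
      using sum_squares_bound[of "cmod (u z)" "cmod (v z)"] by simp
    moreover have "0 \<le> cmod (u z) * cmod (v z)" by simp
    ultimately show ?thesis by (simp only: norm_mult complex_mod_cnj)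
  qed
  then show "AE z in M. norm (u z * cnj (v z)) \<le> norm ((cmod (u z))\<^sup>2 + (cmod (v z))\<^sup>2)"
    by (intro AE_I2) (simp del: norm_mult)
qed

lemma ip_add_left: "u \<in> H \<Longrightarrow> v \<in> H \<Longrightarrow> w \<in> H \<Longrightarrow> ip (\<lambda>z. u z + v z) w = ip u w + ip v w"
  unfolding ip_def by (simp add: distrib_right integrable_ip)

lemma ip_cmult_left: "ip (\<lambda>z. c * u z) w = c * ip u w"
  unfolding ip_def by (simp add: mult.assoc)

lemma ip_cnj: "cnj (ip u v) = ip v u"
  unfolding ip_def by (simp add: mult.commute flip: Bochner_Integration.integral_cnj)

lemma ip_diff_left: "u \<in> H \<Longrightarrow> v \<in> H \<Longrightarrow> w \<in> H \<Longrightarrow> ip (\<lambda>z. u z - v z) w = ip u w - ip v w"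
  using ip_add_left[OF _ H_cmult, of u v w "-1"] ip_cmult_left[of "-1" v w] by simp

lemma ip_add_right: "u \<in> H \<Longrightarrow> v \<in> H \<Longrightarrow> w \<in> H \<Longrightarrow> ip w (\<lambda>z. u z + v z) = ip w u + ip w v"
  by (subst (1 2 3) ip_cnj[symmetric]) (simp add: ip_add_left)

lemma ip_cmult_right: "ip w (\<lambda>z. c * u z) = cnj c * ip w u"
  by (subst (1 2) ip_cnj[symmetric]) (simp add: ip_cmult_left)

lemma ip_sum_left:
  assumes "\<And>i. i \<in> I \<Longrightarrow> f i \<in> H" "w \<in> H"
  shows "ip (\<lambda>z. \<Sum>i\<in>I. f i z) w = (\<Sum>i\<in>I. ip (f i) w)"
  using assms by (induction I rule: infinite_finite_induct)
    (simp_all add: ip_add_left H_sum, simp_all add: ip_def)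

lemma ip_self: "ip u u = of_real ((N u)\<^sup>2)"
proof -
  have "(\<lambda>z. u z * cnj (u z)) = (\<lambda>z. of_real ((cmod (u z))\<^sup>2))"
    by (simp add: complex_norm_square[symmetric])
  then have "ip u u = of_real (LINT z|M. (cmod (u z))\<^sup>2)"
    unfolding ip_def by (simp only: integral_complex_of_real)
  moreover have "(LINT z|M. (cmod (u z))\<^sup>2) \<ge> 0" by (rule Bochner_Integration.integral_nonneg) simp
  ultimately show ?thesis by (simp add: bergman_norm_def)
qed

lemma N_nonneg: "N u \<ge> 0"
  by (simp add: bergman_norm_def)

lemma N_power2_add:
  assumes "u \<in> H" "v \<in> H"
  shows "(N (\<lambda>z. u z + c * v z))\<^sup>2 = (N u)\<^sup>2 + 2 * Re (cnj c * ip u v) + (cmod c)\<^sup>2 * (N v)\<^sup>2"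
proof -
  note [simp] = assms H_cmult H_add
  have "complex_of_real ((N (\<lambda>z. u z + c * v z))\<^sup>2) = ip (\<lambda>z. u z + c * v z) (\<lambda>z. u z + c * v z)"
    by (simp only: ip_self)
  also have "\<dots> = ip u u + (cnj c * ip u v + cnj (cnj c * ip u v)) + c * cnj c * ip v v"
    by (simp add: ip_add_left ip_add_right ip_cmult_left ip_cmult_right ip_cnj algebra_simps)
  also have "\<dots> = of_real ((N u)\<^sup>2 + 2 * Re (cnj c * ip u v) + (cmod c)\<^sup>2 * (N v)\<^sup>2)"
    by (simp only: complex_add_cnj ip_self complex_norm_square[symmetric] of_real_add of_real_mult)
  finally show ?thesis by (simp only: of_real_eq_iff)
qed

lemma N_cmult: "(N (\<lambda>z. c * u z))\<^sup>2 = (cmod c)\<^sup>2 * (N u)\<^sup>2"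
  by (simp add: bergman_norm_def norm_mult power_mult_distrib)

lemma Cauchy_Schwarz_ip:
  assumes "u \<in> H" "v \<in> H"
  shows "(cmod (ip u v))\<^sup>2 \<le> (N u)\<^sup>2 * (N v)\<^sup>2"
proof -
  let ?a = "ip u v"
  \<comment> \<open>Expansion of the squared norm of \<open>u - s * ip u v * v\<close> for real
    \<open>s\<close>.\<close>
  have "0 \<le> (N u)\<^sup>2 - 2 * s * (cmod ?a)\<^sup>2 + s\<^sup>2 * (cmod ?a)\<^sup>2 * (N v)\<^sup>2" for s :: real
  proof -
    have "cnj (- of_real s * ?a) * ?a = of_real (- s) * of_real ((cmod ?a)\<^sup>2)"
      unfolding complex_norm_square by simp
    then have "Re (cnj (- of_real s * ?a) * ?a) = - s * (cmod ?a)\<^sup>2"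
      by (simp only: Re_complex_of_real flip: of_real_mult)
    then show ?thesis
      using N_power2_add[OF assms, of "- of_real s * ?a"] zero_le_power2[of "N (\<lambda>z. u z + - of_real s * ?a * v z)"]
      by (simp add: norm_mult power_mult_distrib)
  qed
  note pos = this
  show ?thesis
  proof (cases "N v = 0")
    case True
    show ?thesis
    proof (rule ccontr)
      assume "\<not> ?thesis"
      then have a: "(cmod ?a)\<^sup>2 > 0" using True by simp
      \<comment> \<open>With \<open>N v = 0\<close> the expression is affine in \<open>s\<close>,
        and the value of \<open>s\<close> below makes it equal to -1.\<close>
      then show False
        using pos[of "((N u)\<^sup>2 + 1) / (2 * (cmod ?a)\<^sup>2)"] True by (simp add: field_simps)
    qed
  next
    case False
    define D where "D = (N v)\<^sup>2"
    have D: "D > 0" using False by (simp add: D_def)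
    have "0 \<le> (N u)\<^sup>2 - 2 * (1 / D) * (cmod ?a)\<^sup>2 + (1 / D)\<^sup>2 * (cmod ?a)\<^sup>2 * D"
      using pos[of "1 / D"] by (simp only: D_def)
    moreover have "(1 / D)\<^sup>2 * (cmod ?a)\<^sup>2 * D = (cmod ?a)\<^sup>2 / D" using D by (simp add: power2_eq_square)
    ultimately have "(cmod ?a)\<^sup>2 / D \<le> (N u)\<^sup>2" by simp
    then show ?thesis using D by (simp add: pos_divide_le_eq D_def)
  qed
qed

lemma cmod_ip_le: "u \<in> H \<Longrightarrow> v \<in> H \<Longrightarrow> cmod (ip u v) \<le> N u * N v"
  by (rule power2_le_imp_le) (simp_all add: Cauchy_Schwarz_ip power_mult_distrib N_nonneg)

section \<open>Completeness and the Riesz representation\<close>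

lemma evaluation_bound:
  assumes "compact A" "A \<subseteq> \<Omega>"
  obtains C where "C > 0" "\<And>u z. u \<in> H \<Longrightarrow> z \<in> A \<Longrightarrow> cmod (u z) \<le> C * N u"
proof -
  have "\<exists>C>0. \<forall>u\<in>H. \<forall>z\<in>A. cmod (u z) \<le> C * N u"
    using admissible assms by (simp add: admissible_weight_def)
  then obtain C where "C > 0" "\<forall>u\<in>H. \<forall>z\<in>A. cmod (u z) \<le> C * N u" by (elim exE conjE)
  then show thesis by (intro that) auto
qed

text \<open>By admissibility a Cauchy sequence in norm is uniformly Cauchy on compact sets, which
  yields a holomorphic pointwise limit. Fatou's lemma then turns pointwise convergence into
  convergence in norm.\<close>

lemma H_complete:
  assumes f: "\<And>n. f n \<in> H"
    and cauchy: "\<And>e. e > 0 \<Longrightarrow> \<exists>K. \<forall>m\<ge>K. \<forall>n\<ge>K. N (\<lambda>z. f m z - f n z) < e"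
  obtains g where "g \<in> H" "(\<lambda>n. N (\<lambda>z. f n z - g z)) \<longlonglongrightarrow> 0"
proof -
  have unif: "\<exists>K. \<forall>m\<ge>K. \<forall>n\<ge>K. \<forall>z\<in>A. cmod (f m z - f n z) < e"
    if A: "compact A" "A \<subseteq> \<Omega>" and e: "e > 0" for A e
  proof -
    obtain C where C: "C > 0" "\<And>u z. u \<in> H \<Longrightarrow> z \<in> A \<Longrightarrow> cmod (u z) \<le> C * N u"
      by (rule evaluation_bound[OF A]) (rule that)
    have "e / C > 0" using e C(1) by simp
    from cauchy[OF this] obtain K where
      K: "\<And>m n. m \<ge> K \<Longrightarrow> n \<ge> K \<Longrightarrow> N (\<lambda>z. f m z - f n z) < e / C" by blast
    have "cmod (f m z - f n z) < e" if "m \<ge> K" "n \<ge> K" "z \<in> A" for m n z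
    proof -
      have "cmod (f m z - f n z) \<le> C * N (\<lambda>z. f m z - f n z)"
        by (rule C(2)[OF H_diff[OF f f] that(3)])
      also have "\<dots> < e" using K[OF that(1,2)] C(1) by (simp add: pos_less_divide_eq mult.commute)
      finally show ?thesis .
    qed
    then show ?thesis by blast
  qed
  define g where "g z = lim (\<lambda>n. f n z)" for z
  have fg: "(\<lambda>n. f n z) \<longlonglongrightarrow> g z" if z: "z \<in> \<Omega>" for z
  proof -
    have "Cauchy (\<lambda>n. f n z)"
      by (rule metric_CauchyI) (use unif[of "{z}"] z in \<open>simp add: dist_norm\<close>)
    then show ?thesis by (simp add: g_def Cauchy_convergent_iff convergent_LIMSEQ_iff)
  qed
  have "uniform_limit A f g sequentially" if A: "compact A" "A \<subseteq> \<Omega>" for A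
  proof (rule uniform_limitI)
    fix e :: real assume e: "e > 0"
    then have "e / 2 > 0" by simp
    from unif[OF A this] obtain K where
      K: "\<And>m n z. m \<ge> K \<Longrightarrow> n \<ge> K \<Longrightarrow> z \<in> A \<Longrightarrow> cmod (f m z - f n z) < e / 2" by blast
    have "dist (f n z) (g z) < e" if "n \<ge> K" "z \<in> A" for n z
    proof -
      have "cmod (f n z - g z) \<le> e / 2"
      proof (rule LIMSEQ_le_const2)
        show "(\<lambda>m. cmod (f n z - f m z)) \<longlonglongrightarrow> cmod (f n z - g z)"
          using that A by (intro tendsto_intros fg) auto
        show "\<exists>M. \<forall>m\<ge>M. cmod (f n z - f m z) \<le> e / 2" using K that by (blast intro: less_imp_le)
      qed
      then show ?thesis using e by (simp add: dist_norm)
    qed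
    then show "\<forall>\<^sub>F n in sequentially. \<forall>z\<in>A. dist (f n z) (g z) < e"
      unfolding eventually_sequentially by blast
  qed
  note ul = this
  have hol: "holomorphic_Cn g \<Omega>"
  proof (rule holomorphic_Cn_limit)
    show "holomorphic_Cn (f n) \<Omega>" for n by (rule H_holomorphic[OF f])
    fix z assume "z \<in> \<Omega>"
    then obtain r where "r > 0" "cball z r \<subseteq> \<Omega>" using open_domain unfolding open_contains_cball by blast
    then show "\<exists>r>0. cball z r \<subseteq> \<Omega> \<and> uniform_limit (cball z r) f g sequentially"
      using ul[OF compact_cball] by blast
  qed
  note [measurable] = holomorphic_measurable[OF hol] H_measurable[OF f]
  have est: "(\<lambda>z. f n z - g z) \<in> H \<and> N (\<lambda>z. f n z - g z) \<le> e"
    if e: "e > 0" and K: "\<And>m n. m \<ge> K \<Longrightarrow> n \<ge> K \<Longrightarrow> N (\<lambda>z. f m z - f n z) < e" and n: "n \<ge> K" for e K n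
  proof -
    have int: "(\<integral>\<^sup>+z. ennreal ((cmod (f n z - f m z))\<^sup>2) \<partial>M) = ennreal ((N (\<lambda>z. f n z - f m z))\<^sup>2)" for m
    proof -
      have "(\<integral>\<^sup>+z. ennreal ((cmod (f n z - f m z))\<^sup>2) \<partial>M) = ennreal (LINT z|M. (cmod (f n z - f m z))\<^sup>2)"
        by (rule nn_integral_eq_integral) (auto intro!: H_integrable[OF H_diff[OF f f]])
      then show ?thesis by (simp add: bergman_norm_def)
    qed
    have lim: "liminf (\<lambda>m. ennreal ((cmod (f n z - f m z))\<^sup>2)) = ennreal ((cmod (f n z - g z))\<^sup>2)"
      if "z \<in> \<Omega>" for z
      by (rule lim_imp_Liminf[OF sequentially_bot]) (intro tendsto_intros tendsto_ennrealI fg that)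
    have "(\<integral>\<^sup>+z. ennreal ((cmod (f n z - g z))\<^sup>2) \<partial>M)
        = (\<integral>\<^sup>+z. liminf (\<lambda>m. ennreal ((cmod (f n z - f m z))\<^sup>2)) \<partial>M)"
      by (rule nn_integral_cong) (simp add: lim space_M)
    also have "\<dots> \<le> liminf (\<lambda>m. \<integral>\<^sup>+z. ennreal ((cmod (f n z - f m z))\<^sup>2) \<partial>M)"
      by (rule nn_integral_liminf) measurable
    also have "\<dots> \<le> ennreal (e\<^sup>2)"
    proof (rule Liminf_le[OF sequentially_bot])
      have "(\<integral>\<^sup>+z. ennreal ((cmod (f n z - f m z))\<^sup>2) \<partial>M) \<le> ennreal (e\<^sup>2)" if "m \<ge> K" for m
        unfolding int using K[OF n that] N_nonneg by (intro ennreal_leI power_mono) auto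
      then show "\<forall>\<^sub>F m in sequentially. (\<integral>\<^sup>+z. ennreal ((cmod (f n z - f m z))\<^sup>2) \<partial>M) \<le> ennreal (e\<^sup>2)"
        unfolding eventually_sequentially by blast
    qed
    finally have le: "(\<integral>\<^sup>+z. ennreal ((cmod (f n z - g z))\<^sup>2) \<partial>M) \<le> ennreal (e\<^sup>2)" .
    have integ: "integrable M (\<lambda>z. (cmod (f n z - g z))\<^sup>2)"
      using le by (intro integrableI_bounded) (auto simp: intro: order_le_less_trans)
    have mem: "(\<lambda>z. f n z - g z) \<in> H"
      by (rule HI[OF holomorphic_Cn_diff[OF H_holomorphic[OF f] hol] integ])
    have "ennreal ((N (\<lambda>z. f n z - g z))\<^sup>2) \<le> ennreal (e\<^sup>2)"
      using le by (subst (asm) nn_integral_eq_integral[OF integ]) (auto simp: bergman_norm_def)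
    then have "(N (\<lambda>z. f n z - g z))\<^sup>2 \<le> e\<^sup>2" by (simp add: ennreal_le_iff)
    then show ?thesis using mem e by (auto intro: power2_le_imp_le)
  qed
  have "\<exists>K. \<forall>n\<ge>K. (\<lambda>z. f n z - g z) \<in> H \<and> N (\<lambda>z. f n z - g z) \<le> e" if e: "e > 0" for e
    using cauchy[OF e] est[OF e] by blast
  note est' = this
  show thesis
  proof
    \<comment> \<open>\<open>g\<close> is the difference of \<open>f n\<close> and
      \<open>f n - g\<close>, both in \<open>H\<close>.\<close>
    obtain n where "(\<lambda>z. f n z - g z) \<in> H" using est'[of 1] by force
    from H_diff[OF f[of n] this] show "g \<in> H" by simp
    show "(\<lambda>n. N (\<lambda>z. f n z - g z)) \<longlonglongrightarrow> 0"
    proof (rule LIMSEQ_I)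
      fix e :: real assume "e > 0"
      then have "e / 2 > 0" by simp
      from est'[OF this] obtain K where "\<And>n. n \<ge> K \<Longrightarrow> N (\<lambda>z. f n z - g z) \<le> e / 2" by blast
      then have "\<forall>n\<ge>K. norm (N (\<lambda>z. f n z - g z) - 0) < e"
        using N_nonneg \<open>e > 0\<close> by force
      then show "\<exists>K. \<forall>n\<ge>K. norm (N (\<lambda>z. f n z - g z) - 0) < e" by blast
    qed
  qed
qed

definition bounded_functional :: "((complex^'n \<Rightarrow> complex) \<Rightarrow> complex) \<Rightarrow> bool" where
  "bounded_functional L \<longleftrightarrow>
     (\<forall>u\<in>H. \<forall>v\<in>H. \<forall>c. L (\<lambda>z. u z + c * v z) = L u + c * L v) \<and> (\<exists>C. \<forall>u\<in>H. cmod (L u) \<le> C * N u)"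

lemma bounded_functional_linear:
  "bounded_functional L \<Longrightarrow> u \<in> H \<Longrightarrow> v \<in> H \<Longrightarrow> L (\<lambda>z. u z + c * v z) = L u + c * L v"
  by (simp add: bounded_functional_def)

text \<open>This is the vanishing of the first variation at a minimum. The test point
  \<open>- a / c\<close> with \<open>c > \<bar>b\<bar>\<close> would make the quadratic
  negative.\<close>

lemma quadratic_nonneg_linear_zero:
  fixes a b :: real
  assumes "\<And>t. 0 \<le> a * t + b * t\<^sup>2"
  shows "a = 0"
proof (rule ccontr)
  assume a: "a \<noteq> 0"
  define c where "c = \<bar>b\<bar> + 1"
  have c: "c > 0" "b \<le> c - 1" by (auto simp: c_def)
  define s where "s = - a / c"
  have "a * s + b * s\<^sup>2 \<le> a * s + (c - 1) * s\<^sup>2" using c(2) by (simp add: mult_right_mono)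
  also have "\<dots> = - (a\<^sup>2) / c\<^sup>2"
    using c(1) by (simp add: s_def field_simps power2_eq_square)
  also have "\<dots> < 0" using a c(1) by simp
  finally show False using assms[of s] by simp
qed

text \<open>The representer is found by minimising \<open>\<parallel>u\<parallel>\<^sup>2 - 2 Re (L u)\<close>; the parallelogram law makes
  every minimising sequence Cauchy.\<close>

lemma Riesz_representation:
  assumes L: "bounded_functional L"
  shows "\<exists>k\<in>H. \<forall>u\<in>H. L u = ip u k"
proof -
  obtain C0 where C0: "\<And>u. u \<in> H \<Longrightarrow> cmod (L u) \<le> C0 * N u"
    using L unfolding bounded_functional_def by blast
  define C where "C = max C0 0"
  have C: "cmod (L u) \<le> C * N u" if "u \<in> H" for u
    using C0[OF that] mult_right_mono[of C0 C "N u"] N_nonneg by (simp add: C_def)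
  note lin = bounded_functional_linear[OF L]
  define J where "J u = (N u)\<^sup>2 - 2 * Re (L u)" for u
  have J_add: "J (\<lambda>z. u z + c * v z) = J u + 2 * Re (cnj c * ip u v - c * L v) + (cmod c)\<^sup>2 * (N v)\<^sup>2"
    if "u \<in> H" "v \<in> H" for u v c
    unfolding J_def using that by (simp add: N_power2_add lin algebra_simps)
  have bdd: "J u \<ge> - C\<^sup>2" if "u \<in> H" for u
  proof -
    have "Re (L u) \<le> C * N u" using C[OF that] complex_Re_le_cmod[of "L u"] by linarith
    moreover have "(N u - C)\<^sup>2 \<ge> 0" by simp
    ultimately show ?thesis unfolding J_def power2_diff by (simp add: algebra_simps)
  qed
  define m where "m = Inf (J ` H)"
  have bb: "bdd_below (J ` H)" by (rule bdd_belowI2) (rule bdd)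
  have m: "m \<le> J u" if "u \<in> H" for u
    unfolding m_def using bb that by (rule cINF_lower)
  have "\<exists>u\<in>H. J u < m + inverse (real (Suc n))" for n
    using cInf_lessD[of "J ` H" "m + inverse (real (Suc n))"] H_zero unfolding m_def by auto
  then obtain f where f: "\<And>n. f n \<in> H" and Jf: "\<And>n. J (f n) < m + inverse (real (Suc n))" by metis
  have par: "(N (\<lambda>z. u z - v z))\<^sup>2 \<le> 2 * (J u - m) + 2 * (J v - m)" if uv: "u \<in> H" "v \<in> H" for u v
  proof -
    define d where "d z = v z - u z" for z
    have d: "d \<in> H" unfolding d_def[abs_def] by (rule H_diff[OF uv(2,1)])
    have v: "v = (\<lambda>z. u z + 1 * d z)" by (simp add: d_def)
    \<comment> \<open>Expansions at \<open>v\<close> and at the midpoint; eliminating the common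
      linear term leaves the parallelogram identity.\<close>
    have "J v = J u + 2 * Re (ip u d - L d) + (N d)\<^sup>2"
      by (subst v) (simp only: J_add[OF uv(1) d], simp)
    moreover have "J (\<lambda>z. u z + (1/2) * d z) = J u + Re (ip u d - L d) + (1/4) * (N d)\<^sup>2"
      unfolding J_add[OF uv(1) d] by (simp add: power_divide norm_divide)
    moreover have "m \<le> J (\<lambda>z. u z + (1/2) * d z)" by (intro m H_add H_cmult uv d)
    moreover have "(N (\<lambda>z. u z - v z))\<^sup>2 = (N d)\<^sup>2"
      using N_cmult[of "-1" d] by (simp add: d_def)
    ultimately show ?thesis by argo
  qed
  have "\<exists>K. \<forall>i\<ge>K. \<forall>j\<ge>K. N (\<lambda>z. f i z - f j z) < e" if e: "e > 0" for e
  proof -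
    have "e\<^sup>2 / 4 > 0" using e by simp
    then obtain K where K: "K > 0" "inverse (real K) < e\<^sup>2 / 4" using ex_inverse_of_nat_less by blast
    have "N (\<lambda>z. f i z - f j z) < e" if "i \<ge> K" "j \<ge> K" for i j
    proof -
      have small: "J (f i) - m < e\<^sup>2 / 4" if "i \<ge> K" for i
      proof -
        have "inverse (real (Suc i)) \<le> inverse (real K)" using K(1) that by (intro le_imp_inverse_le) auto
        then show ?thesis using Jf[of i] K(2) by linarith
      qed
      have "(N (\<lambda>z. f i z - f j z))\<^sup>2 < e\<^sup>2" using par[OF f f, of i j] small[OF that(1)] small[OF that(2)] by argo
      then show ?thesis using e by (auto intro: power2_less_imp_less)
    qed
    then show ?thesis by blast
  qed
  note cauchy = this
  obtain g where g: "g \<in> H" and fg: "(\<lambda>n. N (\<lambda>z. f n z - g z)) \<longlonglongrightarrow> 0"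
    by (rule H_complete[OF f cauchy])
  have Jg: "J g \<le> m"
  proof (rule LIMSEQ_le)
    define d where "d n z = f n z - g z" for n z
    have d: "d n \<in> H" for n unfolding d_def[abs_def] by (rule H_diff[OF f g])
    have f_eq: "f n = (\<lambda>z. g z + 1 * d n z)" for n by (simp add: d_def)
    show "(\<lambda>n. m + inverse (real (Suc n))) \<longlonglongrightarrow> m"
      using tendsto_add[OF tendsto_const[of m] LIMSEQ_inverse_real_of_nat] by simp
    \<comment> \<open>Expansion at \<open>g\<close> bounds \<open>J (f n)\<close> from below by
      \<open>J g\<close> up to a multiple of \<open>N (d n)\<close>, which tends to 0. Hence
      \<open>g\<close> attains the infimum.\<close>
    have "J g - 2 * (N g + C) * N (d n) \<le> J (f n)" for n
    proof -
      have "J (f n) = J g + 2 * Re (ip g (d n) - L (d n)) + (N (d n))\<^sup>2"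
        by (subst f_eq) (simp only: J_add[OF g d], simp)
      moreover have "\<bar>Re (ip g (d n) - L (d n))\<bar> \<le> N g * N (d n) + C * N (d n)"
        using abs_Re_le_cmod[of "ip g (d n) - L (d n)"] norm_triangle_ineq4[of "ip g (d n)" "L (d n)"]
          cmod_ip_le[OF g d, of n] C[OF d, of n] by linarith
      moreover have "(N (d n))\<^sup>2 \<ge> 0" by simp
      moreover have "2 * (N g + C) * N (d n) = 2 * (N g * N (d n) + C * N (d n))" by algebra
      moreover have "j0 - e \<le> j1"
        if "j1 = j0 + 2 * x + y" "\<bar>x\<bar> \<le> b" "0 \<le> y" "e = 2 * b" for j0 j1 x y b e :: real
        using that by linarith
      ultimately show ?thesis by blast
    qed
    then show "\<exists>K. \<forall>n\<ge>K. J g - 2 * (N g + C) * N (d n) \<le> m + inverse (real (Suc n))"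
      using Jf by (blast intro: less_imp_le order_trans)
    have "(\<lambda>n. J g - 2 * (N g + C) * N (d n)) \<longlonglongrightarrow> J g - 2 * (N g + C) * 0"
      using fg unfolding d_def[abs_def] by (intro tendsto_intros)
    then show "(\<lambda>n. J g - 2 * (N g + C) * N (d n)) \<longlonglongrightarrow> J g" by simp
  qed
  \<comment> \<open>First variation of \<open>J\<close> at the minimiser; the choices
    \<open>1\<close> and \<open>\<i>\<close> for \<open>c\<close> give the real and the imaginary
    part of the representation.\<close>
  have var: "Re (cnj c * ip g u - c * L u) = 0" if u: "u \<in> H" for u c
  proof -
    have "0 \<le> (2 * Re (cnj c * ip g u - c * L u)) * t + ((cmod c)\<^sup>2 * (N u)\<^sup>2) * t\<^sup>2" for t
    proof -
      have "J g \<le> J (\<lambda>z. g z + of_real t * c * u z)"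
        by (rule order_trans[OF Jg m]) (intro H_add H_cmult g u)
      then show ?thesis
        unfolding J_add[OF g u] by (simp add: norm_mult power_mult_distrib algebra_simps)
    qed
    from quadratic_nonneg_linear_zero[OF this] show ?thesis by simp
  qed
  have "L u = ip u g" if u: "u \<in> H" for u
  proof (rule complex_eqI)
    show "Re (L u) = Re (ip u g)" using var[OF u, of 1] by (simp add: ip_cnj[symmetric, of g u])
    show "Im (L u) = Im (ip u g)" using var[OF u, of \<i>] by (simp add: ip_cnj[symmetric, of g u])
  qed
  then show ?thesis using g by blast
qed

text \<open>Members of \<open>H\<close> are total functions, so a representer is determined only on
  \<open>\<Omega>\<close> and has to be chosen.\<close>

definition rep :: "((complex^'n \<Rightarrow> complex) \<Rightarrow> complex) \<Rightarrow> complex^'n \<Rightarrow> complex" where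
  "rep L = (SOME k. k \<in> H \<and> (\<forall>u\<in>H. L u = ip u k))"

lemma
  assumes "bounded_functional L"
  shows rep_in_H: "rep L \<in> H" and rep_eq: "u \<in> H \<Longrightarrow> L u = ip u (rep L)"
proof -
  have "\<exists>k. k \<in> H \<and> (\<forall>u\<in>H. L u = ip u k)" using Riesz_representation[OF assms] by blast
  from someI_ex[OF this] show "rep L \<in> H" "u \<in> H \<Longrightarrow> L u = ip u (rep L)" unfolding rep_def by blast+
qed

text \<open>Both sides are the inner product of the two representers. For functionals at two points,
  this trades dependence on one point for dependence on the other.\<close>

lemma rep_commute:
  assumes "bounded_functional L" "bounded_functional L'"
  shows "L (rep L') = cnj (L' (rep L))"
  using assms by (simp add: rep_eq rep_in_H ip_cnj)

section \<open>The reproducing kernel\<close>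

abbreviation "K \<equiv> bergman_kernel \<Omega> \<mu>"

lemma
  assumes w: "w \<in> \<Omega>"
  shows kernel_in_H: "(\<lambda>z. K z w) \<in> H" and kernel_reproducing: "u \<in> H \<Longrightarrow> u w = ip u (\<lambda>z. K z w)"
proof -
  have "bounded_functional (\<lambda>u. u w)" if w: "w \<in> \<Omega>" for w
  proof -
    obtain C where "C > 0" "\<And>u z. u \<in> H \<Longrightarrow> z \<in> {w} \<Longrightarrow> cmod (u z) \<le> C * N u"
      by (rule evaluation_bound[of "{w}"]) (use w in auto)
    then show ?thesis unfolding bounded_functional_def by blast
  qed
  note ev = this
  \<comment> \<open>Representers of the evaluations form a reproducing kernel, so the choice made in
    \<open>bergman_kernel\<close> is one.\<close>
  have "is_reproducing_kernel \<Omega> \<mu> (\<lambda>z w. rep (\<lambda>u. u w) z)"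
    unfolding is_reproducing_kernel_def
    using rep_in_H[OF ev] rep_eq[OF ev] by (auto simp: ip_def)
  then have "is_reproducing_kernel \<Omega> \<mu> K" unfolding bergman_kernel_def by (rule someI[of "is_reproducing_kernel \<Omega> \<mu>"])
  then show "(\<lambda>z. K z w) \<in> H" "u \<in> H \<Longrightarrow> u w = ip u (\<lambda>z. K z w)"
    using w unfolding is_reproducing_kernel_def ip_def by blast+
qed

text \<open>The diagonal value is the squared norm of the kernel function; if it vanished, the
  constant function 1 would vanish at \<open>w\<close>.\<close>

lemma kernel_diagonal_pos:
  assumes w: "w \<in> \<Omega>"
  shows "\<exists>x>0. K w w = of_real x"
proof -
  let ?k = "\<lambda>z. K z w"
  have "K w w = of_real ((N ?k)\<^sup>2)"
    using kernel_reproducing[OF w kernel_in_H[OF w]] by (simp only: ip_self)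
  moreover have "N ?k \<noteq> 0"
  proof
    assume "N ?k = 0"
    moreover have one: "(\<lambda>z. 1) \<in> H" by (rule H_bounded[OF holomorphic_Cn_const]) (auto simp: bounded_iff intro!: exI[of _ 1])
    ultimately have "ip (\<lambda>z. 1) ?k = 0" using cmod_ip_le[OF one kernel_in_H[OF w]] by simp
    then show False using kernel_reproducing[OF w one] by simp
  qed
  ultimately show ?thesis by (intro exI[of _ "(N ?k)\<^sup>2"]) auto
qed

end

section \<open>Wirtinger derivatives in a complex direction\<close>

text \<open>\<open>a\<close> and \<open>b\<close> are the holomorphic and antiholomorphic
  derivatives along a complex line; for \<open>v = axis j 1\<close> they are
  \<open>partial_z j\<close> and \<open>partial_zbar j\<close>. The relational form carries
  differentiability through the calculus rules and demands it only along that line.\<close>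

definition has_wirtinger ::
  "complex^'n \<Rightarrow> (complex^'n \<Rightarrow> complex) \<Rightarrow> complex^'n \<Rightarrow> complex \<Rightarrow> complex \<Rightarrow> bool" where
  "has_wirtinger v f z a b \<longleftrightarrow>
     ((\<lambda>t. f (z + t *s v)) has_derivative (\<lambda>h. a * h + b * cnj h)) (at 0)"

lemma partial_real_wirtinger:
  assumes "has_wirtinger (axis j 1) f z a b"
  shows "partial_real j c f z = a * c + b * cnj c"
proof -
  have "((\<lambda>t::real. of_real t * c) has_derivative (\<lambda>t. of_real t * c)) (at 0)"
    by (intro derivative_intros)
  moreover have "((\<lambda>t. f (z + t *s axis j 1)) has_derivative (\<lambda>h. a * h + b * cnj h)) (at (of_real 0 * c))"
    using assms by (simp add: has_wirtinger_def)
  ultimately have "((\<lambda>t::real. f (z + (of_real t * c) *s axis j 1)) has_derivative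
      (\<lambda>t. a * (of_real t * c) + b * cnj (of_real t * c))) (at 0)"
    by (rule has_derivative_compose)
  moreover have "(of_real t * c) *s axis j 1 = t *\<^sub>R axis j c" for t :: real
    by (simp add: vec_eq_iff axis_def scaleR_conv_of_real[of t c])
  moreover have "(\<lambda>t. a * (of_real t * c) + b * cnj (of_real t * c)) = (\<lambda>t::real. t *\<^sub>R (a * c + b * cnj c))"
    by (simp add: fun_eq_iff scaleR_conv_of_real algebra_simps)
  ultimately have "((\<lambda>t. f (z + t *\<^sub>R axis j c)) has_vector_derivative (a * c + b * cnj c)) (at 0)"
    by (simp only: has_vector_derivative_def)
  then show ?thesis unfolding partial_real_def by (rule vector_derivative_at)
qed

lemma partial_z_wirtinger: "has_wirtinger (axis j 1) f z a b \<Longrightarrow> partial_z j f z = a"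
  and partial_zbar_wirtinger: "has_wirtinger (axis j 1) f z a b \<Longrightarrow> partial_zbar j f z = b"
  by (simp_all add: partial_z_def partial_zbar_def partial_real_wirtinger algebra_simps flip: mult.assoc)

lemma has_wirtinger_transform:
  assumes f: "has_wirtinger v f z a b" and S: "open S" "z \<in> S" and eq: "\<And>w. w \<in> S \<Longrightarrow> f w = g w"
  shows "has_wirtinger v g z a b"
proof -
  have "open ((\<lambda>t. z + t *s v) -` S)"
    by (intro open_vimage S continuous_intros linear_continuous_on bounded_linear_scalar_mult_vec)
  then show ?thesis
    using f eq S unfolding has_wirtinger_def
    by (elim has_derivative_transform_within_open[where t = UNIV, simplified]) auto
qed

lemma has_wirtinger_holomorphic:
  assumes "holomorphic_Cn f S" "z \<in> S"
  shows "has_wirtinger v f z (dir_deriv v f z) 0"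
  using holomorphic_Cn_line[OF assms(1), of z 0 v] assms(2)
  by (simp add: has_wirtinger_def has_field_derivative_def)

lemma has_wirtinger_cnj:
  assumes "has_wirtinger v f z a b"
  shows "has_wirtinger v (\<lambda>w. cnj (f w)) z (cnj b) (cnj a)"
  using has_derivative_cnj[OF assms[unfolded has_wirtinger_def]]
  by (simp add: has_wirtinger_def add.commute)

lemma has_wirtinger_add:
  assumes "has_wirtinger v f z a b" "has_wirtinger v g z c d"
  shows "has_wirtinger v (\<lambda>w. f w + g w) z (a + c) (b + d)"
  using has_derivative_add[OF assms[unfolded has_wirtinger_def]]
  by (simp add: has_wirtinger_def algebra_simps)

lemma has_wirtinger_diff:
  assumes "has_wirtinger v f z a b" "has_wirtinger v g z c d"
  shows "has_wirtinger v (\<lambda>w. f w - g w) z (a - c) (b - d)"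
  using has_derivative_diff[OF assms[unfolded has_wirtinger_def]]
  by (simp add: has_wirtinger_def algebra_simps)

lemma has_wirtinger_mult:
  assumes "has_wirtinger v f z a b" "has_wirtinger v g z c d"
  shows "has_wirtinger v (\<lambda>w. f w * g w) z (f z * c + a * g z) (f z * d + b * g z)"
  using has_derivative_mult[OF assms[unfolded has_wirtinger_def]]
  by (simp add: has_wirtinger_def algebra_simps)

lemma has_wirtinger_compose_field:
  assumes f: "has_wirtinger v f z a b" and F: "(F has_field_derivative d) (at (f z))"
  shows "has_wirtinger v (\<lambda>w. F (f w)) z (d * a) (d * b)"
proof -
  have "(F has_derivative (*) d) (at (f (z + 0 *s v)))"
    using F by (simp add: has_field_derivative_def)
  from has_derivative_compose[OF f[unfolded has_wirtinger_def] this]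
  show ?thesis by (simp add: has_wirtinger_def algebra_simps)
qed

lemma has_wirtinger_inverse:
  assumes f: "has_wirtinger v f z a b" and nz: "f z \<noteq> 0"
  shows "has_wirtinger v (\<lambda>w. inverse (f w)) z (- (inverse (f z))\<^sup>2 * a) (- (inverse (f z))\<^sup>2 * b)"
  by (rule has_wirtinger_compose_field[OF f])
    (use DERIV_inverse[OF nz] in \<open>simp add: power2_eq_square\<close>)

text \<open>Caratheodory's criterion: the cofactor of \<open>t\<close> need only be continuous. It
  will be applied to an antiholomorphic cofactor.\<close>

lemma isCont_mult_ident_derivative:
  fixes c :: "complex \<Rightarrow> complex"
  assumes "isCont c 0"
  shows "((\<lambda>t. t * c t) has_derivative (\<lambda>h. c 0 * h)) (at 0)"
proof -
  have "((\<lambda>t. t * c t) has_field_derivative c 0) (at 0)"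
    unfolding CARAT_DERIV using assms by (intro exI[of _ c]) (simp add: mult.commute)
  then show ?thesis by (simp add: has_field_derivative_def)
qed

lemma quadratic_bound_derivative_zero:
  fixes R :: "complex \<Rightarrow> complex"
  assumes \<delta>: "\<delta> > 0" and R: "\<And>t. cmod t < \<delta> \<Longrightarrow> cmod (R t) \<le> C * (cmod t)\<^sup>2"
  shows "(R has_derivative (\<lambda>h. 0)) (at 0)"
proof -
  have R0: "R 0 = 0" using R[of 0] \<delta> by simp
  have "((\<lambda>t. R t / t) \<longlongrightarrow> 0) (at 0)"
  proof (rule Lim_null_comparison)
    have "cmod (R t / t) \<le> C * cmod t" if "dist t 0 < \<delta>" "t \<noteq> 0" for t
      using R[of t] that by (simp add: norm_divide pos_divide_le_eq power2_eq_square mult.assoc)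
    then show "\<forall>\<^sub>F t in at 0. cmod (R t / t) \<le> C * cmod t"
      unfolding eventually_at using \<delta> by blast
    have "((\<lambda>t::complex. C * cmod t) \<longlongrightarrow> C * cmod 0) (at 0)" by (intro tendsto_intros)
    then show "((\<lambda>t::complex. C * cmod t) \<longlongrightarrow> 0) (at 0)" by simp
  qed
  then have "(R has_field_derivative 0) (at 0)"
    by (simp add: has_field_derivative_iff R0)
  then show ?thesis by (simp add: has_field_derivative_def lambda_zero)
qed

section \<open>Representers of the normalised derivatives\<close>

locale weighted_domain_at = weighted_domain \<Omega> \<mu>
  for \<Omega> :: "(complex^'n) set" and \<mu> :: "complex^'n \<Rightarrow> real" +
  fixes p :: "complex^'n"
  assumes p_in: "p \<in> \<Omega>"
begin

definition \<kappa> :: real where "\<kappa> = Re (K p p)"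

lemma \<kappa>: "\<kappa> > 0" "K p p = of_real \<kappa>"
  using kernel_diagonal_pos[OF p_in] by (auto simp: \<kappa>_def)

definition \<phi> :: "complex^'n \<Rightarrow> complex" where "\<phi> z = of_real (1 / sqrt \<kappa>) * K z p"

lemma \<phi>_in_H: "\<phi> \<in> H"
  unfolding \<phi>_def[abs_def] by (rule H_cmult[OF kernel_in_H[OF p_in]])

lemma ip_\<phi>: "u \<in> H \<Longrightarrow> ip u \<phi> = u p / of_real (sqrt \<kappa>)"
  unfolding \<phi>_def[abs_def] ip_cmult_right using kernel_reproducing[OF p_in, of u] by simp

lemma \<phi>_p: "\<phi> p = of_real (sqrt \<kappa>)"
proof -
  have "1 / sqrt \<kappa> * \<kappa> = sqrt \<kappa>" using \<kappa>(1) by (simp add: real_div_sqrt)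
  then show ?thesis unfolding \<phi>_def \<kappa>(2) by (simp only: flip: of_real_mult)
qed

lemma N_\<phi>: "(N \<phi>)\<^sup>2 = 1"
proof -
  have "of_real ((N \<phi>)\<^sup>2) = (of_real 1 :: complex)"
    using ip_\<phi>[OF \<phi>_in_H] \<kappa>(1) by (simp only: ip_self \<phi>_p) simp
  then show ?thesis by (simp only: of_real_eq_iff)
qed

lemma ex_radius: "\<exists>r>0. cball p r \<subseteq> \<Omega> \<and> (\<forall>z\<in>cball p r. \<phi> z \<noteq> 0)"
proof -
  have "open (\<Omega> \<inter> \<phi> -` (- {0}))"
    by (rule continuous_open_preimage[OF holomorphic_Cn_continuous_on[OF H_holomorphic[OF \<phi>_in_H]] open_domain])
      auto
  moreover have "p \<in> \<Omega> \<inter> \<phi> -` (- {0})" using p_in \<phi>_p \<kappa>(1) by simp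
  ultimately obtain r where "r > 0" "cball p r \<subseteq> \<Omega> \<inter> \<phi> -` (- {0})"
    unfolding open_contains_cball by blast
  then show ?thesis by blast
qed

definition r0 :: real where "r0 = (SOME r. r > 0 \<and> cball p r \<subseteq> \<Omega> \<and> (\<forall>z\<in>cball p r. \<phi> z \<noteq> 0))"

lemma r0: "r0 > 0" "cball p r0 \<subseteq> \<Omega>" "z \<in> cball p r0 \<Longrightarrow> \<phi> z \<noteq> 0"
  using someI_ex[OF ex_radius] unfolding r0_def[symmetric] by auto

definition U :: "(complex^'n) set" where "U = ball p r0"

lemma U: "open U" "p \<in> U" "U \<subseteq> \<Omega>" "z \<in> U \<Longrightarrow> \<phi> z \<noteq> 0"
proof -
  have "U \<subseteq> cball p r0" by (auto simp: U_def)
  then show "open U" "p \<in> U" "U \<subseteq> \<Omega>" "z \<in> U \<Longrightarrow> \<phi> z \<noteq> 0"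
    using r0 by (auto simp: U_def)
qed

text \<open>The head of the list is the outermost derivative. Dividing by \<open>\<phi>\<close>
  before differentiating is what removes the pure derivatives of the Gram function at
  \<open>p\<close>.\<close>

fun D :: "(complex^'n) list \<Rightarrow> (complex^'n \<Rightarrow> complex) \<Rightarrow> complex^'n \<Rightarrow> complex" where
  "D [] u = (\<lambda>z. u z / \<phi> z)"
| "D (v # I) u = dir_deriv v (D I u)"

lemma holomorphic_D: "u \<in> H \<Longrightarrow> holomorphic_Cn (D I u) U"
proof (induction I)
  case Nil
  then show ?case
    using U by (auto intro!: holomorphic_Cn_divide intro: holomorphic_Cn_subset[OF H_holomorphic] \<phi>_in_H)
next
  case (Cons v I)
  then show ?case by (auto intro: holomorphic_Cn_dir_deriv[OF _ U(1)])
qed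

lemma D_linear:
  assumes u: "u \<in> H" and v: "v \<in> H"
  shows "z \<in> U \<Longrightarrow> D I (\<lambda>z. u z + c * v z) z = D I u z + c * D I v z"
proof (induction I arbitrary: z)
  case Nil
  then show ?case by (simp add: add_divide_distrib)
next
  case (Cons w I)
  note h = holomorphic_D[OF u, of I] holomorphic_D[OF v, of I]
  note hc = holomorphic_Cn_cmult[OF h(2), of c]
  have "dir_deriv w (D I (\<lambda>z. u z + c * v z)) z = dir_deriv w (\<lambda>z. D I u z + c * D I v z) z"
    by (rule dir_deriv_cong[OF holomorphic_Cn_add[OF h(1) hc] U(1) Cons.prems]) (simp add: Cons.IH)
  also have "\<dots> = dir_deriv w (D I u) z + c * dir_deriv w (D I v) z"
    using dir_deriv_add[OF h(1) hc Cons.prems, of w] dir_deriv_cmult[OF h(2) Cons.prems, of w c] by simp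
  finally show ?case by simp
qed

text \<open>Induction on the number of derivatives: each one costs a Cauchy estimate on a slightly
  larger ball that still lies in \<open>U\<close>. The base case combines admissibility with a bound
  for \<open>1 / \<phi>\<close>.\<close>

lemma D_bound:
  "s < r0 \<Longrightarrow> \<exists>C\<ge>0. \<forall>u\<in>H. \<forall>z\<in>cball p s. cmod (D I u z) \<le> C * N u"
proof (induction I arbitrary: s)
  case Nil
  have sub: "cball p s \<subseteq> cball p r0" "cball p s \<subseteq> \<Omega>" using r0(2) Nil by auto
  obtain C where C: "C > 0" "\<And>u z. u \<in> H \<Longrightarrow> z \<in> cball p s \<Longrightarrow> cmod (u z) \<le> C * N u"
    by (rule evaluation_bound[OF compact_cball sub(2)]) (rule that)
  have "compact ((\<lambda>z. inverse (\<phi> z)) ` cball p s)"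
    by (intro compact_continuous_image continuous_on_inverse compact_cball
        continuous_on_subset[OF holomorphic_Cn_continuous_on[OF H_holomorphic[OF \<phi>_in_H]] sub(2)])
      (use sub r0(3) in blast)
  then have "bounded ((\<lambda>z. inverse (\<phi> z)) ` cball p s)" by (rule compact_imp_bounded)
  then obtain B where "\<forall>x\<in>(\<lambda>z. inverse (\<phi> z)) ` cball p s. cmod x \<le> B" unfolding bounded_iff by blast
  then have B: "cmod (inverse (\<phi> z)) \<le> \<bar>B\<bar>" if "z \<in> cball p s" for z
    using that abs_ge_self[of B] by (blast intro: order_trans)
  have "cmod (D [] u z) \<le> (C * \<bar>B\<bar>) * N u" if "u \<in> H" "z \<in> cball p s" for u z
  proof -
    have "cmod (D [] u z) = cmod (u z) * cmod (inverse (\<phi> z))"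
      by (simp add: norm_divide norm_inverse divide_inverse norm_mult)
    also have "\<dots> \<le> (C * N u) * \<bar>B\<bar>"
      using C(2)[OF that] B[OF that(2)] C(1) N_nonneg[of u] by (intro mult_mono) auto
    finally show ?thesis by (simp add: mult_ac)
  qed
  then show ?case using C(1) by (intro exI[of _ "C * \<bar>B\<bar>"]) auto
next
  case (Cons v I)
  define s' where "s' = (s + r0) / 2"
  have s': "s < s'" "s' < r0" using Cons.prems by (auto simp: s'_def)
  obtain C where C: "C \<ge> 0" "\<And>u z. u \<in> H \<Longrightarrow> z \<in> cball p s' \<Longrightarrow> cmod (D I u z) \<le> C * N u"
    using Cons.IH[OF s'(2)] by blast
  have "cmod (D (v # I) u z) \<le> (C / (s' - s) * norm v) * N u" if u: "u \<in> H" and z: "z \<in> cball p s" for u z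
  proof -
    have sub: "cball z (s' - s) \<subseteq> cball p s'"
    proof
      fix y assume "y \<in> cball z (s' - s)"
      then show "y \<in> cball p s'" using z dist_triangle[of p y z] by simp
    qed
    have "cball p s' \<subseteq> U" using s'(2) by (auto simp: U_def)
    then have "cmod (dir_deriv v (D I u) z) \<le> C * N u / (s' - s) * norm v"
      using sub s'(1) C(2)[OF u] by (intro Cauchy_estimate_dir_deriv[OF holomorphic_D[OF u]]) auto
    then show ?thesis by (simp add: mult_ac)
  qed
  then show ?case using C(1) s'(1) by (intro exI[of _ "C / (s' - s) * norm v"]) auto
qed

lemma bounded_functional_D:
  assumes z: "z \<in> U"
  shows "bounded_functional (\<lambda>u. D I u z)"
proof -
  have "dist p z < r0" "z \<in> cball p (dist p z)" using z by (auto simp: U_def)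
  then have "\<exists>C. \<forall>u\<in>H. cmod (D I u z) \<le> C * N u" using D_bound[of "dist p z" I] by blast
  then show ?thesis unfolding bounded_functional_def using D_linear[OF _ _ z] by blast
qed

section \<open>The Gram function and its mixed derivatives\<close>

definition rD :: "(complex^'n) list \<Rightarrow> complex^'n \<Rightarrow> complex^'n \<Rightarrow> complex" where
  "rD I z = rep (\<lambda>u. D I u z)"

lemma rD_in_H: "z \<in> U \<Longrightarrow> rD I z \<in> H"
  and D_eq_ip: "z \<in> U \<Longrightarrow> u \<in> H \<Longrightarrow> D I u z = ip u (rD I z)"
  unfolding rD_def by (simp_all add: rep_in_H[OF bounded_functional_D] rep_eq[OF bounded_functional_D, symmetric])

text \<open>By \<open>has_wirtinger_G\<close> this is the derivative of \<open>G [] []\<close> in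
  the holomorphic directions \<open>I\<close> and the antiholomorphic directions \<open>J\<close>.
  Representers make it available before any differentiability is known.\<close>

definition G :: "(complex^'n) list \<Rightarrow> (complex^'n) list \<Rightarrow> complex^'n \<Rightarrow> complex" where
  "G I J z = D I (rD J z) z"

lemma D_rD_commute: "z \<in> U \<Longrightarrow> w \<in> U \<Longrightarrow> D I (rD J w) z = cnj (D J (rD I z) w)"
  unfolding rD_def by (rule rep_commute[OF bounded_functional_D bounded_functional_D])

lemma G_commute: "z \<in> U \<Longrightarrow> G I J z = cnj (G J I z)"
  unfolding G_def by (rule D_rD_commute)

text \<open>The functional is tested on its own representer. This bounds the representers at nearby
  points uniformly.\<close>

lemma N_rD_le:
  assumes z: "z \<in> U" and C: "C \<ge> 0" "\<And>u. u \<in> H \<Longrightarrow> cmod (D I u z) \<le> C * N u"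
  shows "N (rD I z) \<le> C"
proof -
  let ?k = "rD I z"
  have "(N ?k)\<^sup>2 = cmod (D I ?k z)"
    using D_eq_ip[OF z rD_in_H[OF z], of I I] by (simp only: ip_self norm_of_real) simp
  also have "\<dots> \<le> C * N ?k" by (rule C(2)[OF rD_in_H[OF z]])
  finally have "N ?k * N ?k \<le> C * N ?k" by (simp add: power2_eq_square)
  then show ?thesis using N_nonneg[of ?k] C(1) by (cases "N ?k = 0") (auto simp: mult_le_cancel_right)
qed

text \<open>Both the base point and the representer move with \<open>t\<close>. Expanding the
  holomorphic function \<open>D I (k t)\<close> at \<open>z\<close> leaves a remainder that is
  quadratic in \<open>t\<close>, uniformly because the norms of \<open>k t\<close> are bounded. By
  \<open>D_rD_commute\<close> the remaining values at \<open>z\<close> are conjugates of holomorphic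
  functions of \<open>t\<close>.\<close>

lemma has_wirtinger_G:
  assumes z: "z \<in> U"
  shows "has_wirtinger v (G I J) z (G (v # I) J z) (G I (v # J) z)"
proof -
  define k where "k t = rD J (z + t *s v)" for t
  define R where "R t = G I J (z + t *s v) - D I (k t) z - t * D (v # I) (k t) z" for t
  \<comment> \<open>Room for two radii: \<open>cball z (2 * \<delta>)\<close> lies in
    \<open>cball p s\<close>, which lies in \<open>U\<close>, so the bounds of
    \<open>D_bound\<close> hold throughout.\<close>
  define s where "s = (dist p z + r0) / 2"
  define \<delta> where "\<delta> = (s - dist p z) / 2"
  have s: "dist p z < s" "s < r0" using z by (auto simp: s_def U_def)
  have \<delta>: "\<delta> > 0" using s by (simp add: \<delta>_def)
  have sub: "cball z (2 * \<delta>) \<subseteq> cball p s"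
  proof
    fix y assume "y \<in> cball z (2 * \<delta>)"
    then show "y \<in> cball p s" using dist_triangle[of p y z] by (simp add: \<delta>_def)
  qed
  have sU: "cball p s \<subseteq> U" using s(2) by (auto simp: U_def)
  obtain C where C: "C \<ge> 0" "\<And>u z. u \<in> H \<Longrightarrow> z \<in> cball p s \<Longrightarrow> cmod (D I u z) \<le> C * N u"
    using D_bound[OF s(2), of I] by blast
  obtain C' where C': "C' \<ge> 0" "\<And>u z. u \<in> H \<Longrightarrow> z \<in> cball p s \<Longrightarrow> cmod (D J u z) \<le> C' * N u"
    using D_bound[OF s(2), of J] by blast
  define \<epsilon> where "\<epsilon> = \<delta> / (norm v + 1)"
  have nv: "norm v + 1 > 0" by (simp add: add_nonneg_pos)
  have \<epsilon>: "\<epsilon> > 0" using \<delta> nv by (simp add: \<epsilon>_def)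
  have tv: "cmod t * norm v \<le> \<delta>" if "cmod t < \<epsilon>" for t
  proof -
    have "cmod t * norm v \<le> \<epsilon> * (norm v + 1)" using that \<epsilon> by (intro mult_mono) auto
    then show ?thesis using nv by (simp add: \<epsilon>_def)
  qed
  have near: "z + t *s v \<in> cball p s" if "cmod t < \<epsilon>" for t
  proof -
    have "dist z (z + t *s v) \<le> 2 * \<delta>" using tv[OF that] \<delta> by (simp add: dist_norm norm_scalar_mult_vec)
    then show ?thesis using sub by auto
  qed
  have R: "cmod (R t) \<le> (2 * (C * C') / \<delta>\<^sup>2 * (norm v)\<^sup>2) * (cmod t)\<^sup>2" if t: "cmod t < \<epsilon>" for t
  proof -
    have tU: "z + t *s v \<in> U" using near[OF t] sU by blast
    have kH: "k t \<in> H" unfolding k_def by (rule rD_in_H[OF tU])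
    have Nk: "N (k t) \<le> C'" unfolding k_def by (rule N_rD_le[OF tU C'(1) C'(2)[OF _ near[OF t]]])
    have "cmod (D I (k t) (z + t *s v) - D I (k t) z - t * dir_deriv v (D I (k t)) z)
        \<le> 2 * (C * C') / \<delta>\<^sup>2 * (norm v)\<^sup>2 * (cmod t)\<^sup>2"
    proof (rule dir_deriv_quadratic_remainder[OF holomorphic_D[OF kH] U(1) _ \<delta> _ tv[OF t]])
      show "cball z (2 * \<delta>) \<subseteq> U" using sub sU by blast
      fix w assume "w \<in> cball z (2 * \<delta>)"
      then have "cmod (D I (k t) w) \<le> C * N (k t)" using C(2)[OF kH] sub by blast
      also have "\<dots> \<le> C * C'" using Nk C(1) by (rule mult_left_mono)
      finally show "cmod (D I (k t) w) \<le> C * C'" .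
    qed
    then show ?thesis by (simp add: R_def G_def k_def)
  qed
  have R': "(R has_derivative (\<lambda>h. 0)) (at 0)"
    by (rule quadratic_bound_derivative_zero[OF \<epsilon> R])
  have line: "((\<lambda>t. D J u (z + t *s v)) has_field_derivative D (v # J) u z) (at 0)" if "u \<in> H" for u
    using holomorphic_Cn_line[OF holomorphic_D[OF that], of z 0 v J] z by simp
  \<comment> \<open>The zeroth-order term of the expansion is antiholomorphic in \<open>t\<close>
    and supplies the \<open>cnj h\<close> part.\<close>
  have e1: "((\<lambda>t. cnj (D J (rD I z) (z + t *s v))) has_derivative (\<lambda>h. G I (v # J) z * cnj h)) (at 0)"
    using has_derivative_cnj[OF line[OF rD_in_H[OF z], of I, unfolded has_field_derivative_def]]
      G_commute[OF z, of I "v # J"] by (simp add: G_def)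
  \<comment> \<open>In the first-order term only the value of the cofactor at \<open>t = 0\<close>
    matters; it supplies the \<open>h\<close> part.\<close>
  have "isCont (\<lambda>t. cnj (D J (rD (v # I) z) (z + t *s v))) 0"
    by (intro continuous_intros DERIV_isCont[OF line] rD_in_H z)
  from isCont_mult_ident_derivative[OF this]
  have e2: "((\<lambda>t. t * cnj (D J (rD (v # I) z) (z + t *s v))) has_derivative (\<lambda>h. G (v # I) J z * h)) (at 0)"
    using G_commute[OF z, of "v # I" J] by (simp add: G_def del: D.simps)
  have sum: "((\<lambda>t. t * cnj (D J (rD (v # I) z) (z + t *s v)) + cnj (D J (rD I z) (z + t *s v)) + R t)
      has_derivative (\<lambda>h. G (v # I) J z * h + G I (v # J) z * cnj h)) (at 0)"
    using has_derivative_add[OF has_derivative_add[OF e2 e1] R'] by simp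
  have eq: "t * cnj (D J (rD (v # I) z) (z + t *s v)) + cnj (D J (rD I z) (z + t *s v)) + R t
      = G I J (z + t *s v)" if "t \<in> ball 0 \<epsilon>" for t
  proof -
    have "z + t *s v \<in> U" using near[of t] sU that by auto
    then have "D I' (k t) z = cnj (D J (rD I' z) (z + t *s v))" for I'
      unfolding k_def by (rule D_rD_commute[OF z])
    then show ?thesis unfolding R_def by (simp del: D.simps)
  qed
  show ?thesis unfolding has_wirtinger_def
    by (rule has_derivative_transform_within_open[OF sum, where s = "ball 0 \<epsilon>"]) (use \<epsilon> eq in auto)
qed

end

lemma vec_eq_sum_axis: "X = (\<Sum>i\<in>UNIV. X $ i *s axis i 1)" for X :: "complex^'n"
  by (simp add: vec_eq_iff axis_def sum.delta if_distrib cong: if_cong)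

lemma dir_deriv_eq_sum_axis:
  assumes "holomorphic_Cn u S" "z \<in> S"
  shows "dir_deriv X u z = (\<Sum>i\<in>UNIV. X $ i * dir_deriv (axis i 1) u z)"
proof -
  have "dir_deriv X u z = dir_deriv (\<Sum>i\<in>UNIV. X $ i *s axis i 1) u z"
    by (rule arg_cong[where f = "\<lambda>v. dir_deriv v u z", OF vec_eq_sum_axis])
  then show ?thesis by (simp add: dir_deriv_sum_dir[OF assms] dir_deriv_scale[OF assms])
qed

section \<open>The metric and its curvature at the base point\<close>

context weighted_domain_at
begin

lemma D_\<phi>: "z \<in> U \<Longrightarrow> D I \<phi> z = (if I = [] then 1 else 0)"
proof (induction I arbitrary: z)
  case Nil
  then show ?case using U(4) by simp
next
  case (Cons v I)
  have "dir_deriv v (D I \<phi>) z = dir_deriv v (\<lambda>z. if I = [] then 1 else 0) z"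
    by (rule dir_deriv_cong[OF holomorphic_Cn_const U(1) Cons.prems]) (simp add: Cons.IH)
  then show ?case by (simp add: dir_deriv_const)
qed

lemma D_Nil_p: "u \<in> H \<Longrightarrow> D [] u p = ip u \<phi>"
  by (simp add: ip_\<phi> \<phi>_p)

lemma ip_rD_\<phi>: "ip (rD I p) \<phi> = (if I = [] then 1 else 0)"
proof -
  have "ip (rD I p) \<phi> = cnj (D I \<phi> p)"
    by (simp add: D_eq_ip[OF U(2) \<phi>_in_H] ip_cnj)
  then show ?thesis by (simp add: D_\<phi>[OF U(2)])
qed

text \<open>The functional \<open>u \<mapsto> u p / \<phi> p\<close> is represented by
  \<open>\<phi>\<close> itself, and all derivatives of \<open>\<phi> / \<phi>\<close> vanish. Hence
  so do the pure derivatives of the Gram function at \<open>p\<close>.\<close>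

lemma G_Nil_right: "G I [] p = (if I = [] then 1 else 0)"
  and G_Nil_left: "G [] I p = (if I = [] then 1 else 0)"
proof -
  have "G [] I p = ip (rD I p) \<phi>" for I
    unfolding G_def by (rule D_Nil_p[OF rD_in_H[OF U(2)]])
  then show *: "G [] I p = (if I = [] then 1 else 0)" for I by (simp add: ip_rD_\<phi>)
  show "G I [] p = (if I = [] then 1 else 0)" using G_commute[OF U(2), of I "[]"] * by simp
qed

text \<open>The reproducing property evaluates \<open>rD [] z\<close> at \<open>z\<close> as an
  inner product with the kernel function; conjugated, this is the normalised evaluation of the
  kernel function.\<close>

lemma kernel_eq_G:
  assumes z: "z \<in> U"
  shows "K z z = G [] [] z * (\<phi> z * cnj (\<phi> z))"
proof -
  have z\<Omega>: "z \<in> \<Omega>" using z U(3) by blast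
  have real: "cnj (K z z) = K z z" using kernel_diagonal_pos[OF z\<Omega>] by auto
  have "rD [] z z = ip (rD [] z) (\<lambda>w. K w z)"
    by (rule kernel_reproducing[OF z\<Omega> rD_in_H[OF z]])
  also have "\<dots> = cnj (D [] (\<lambda>w. K w z) z)"
    by (simp only: D_eq_ip[OF z kernel_in_H[OF z\<Omega>]] ip_cnj)
  finally have "rD [] z z = K z z / cnj (\<phi> z)" by (simp add: real)
  then show ?thesis using U(4)[OF z] by (simp add: G_def)
qed

lemma G_Nil_Nil_pos:
  assumes z: "z \<in> U"
  shows "\<exists>x>0. G [] [] z = of_real x"
proof -
  obtain x where x: "x > 0" "K z z = of_real x" using kernel_diagonal_pos U(3) z by blast
  have "\<phi> z \<noteq> 0" by (rule U(4)[OF z])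
  then have "G [] [] z = of_real (x / (cmod (\<phi> z))\<^sup>2)"
    using kernel_eq_G[OF z] x(2) by (simp add: complex_norm_square[symmetric] field_simps)
  then show ?thesis using x(1) \<open>\<phi> z \<noteq> 0\<close> by (intro exI[of _ "x / (cmod (\<phi> z))\<^sup>2"]) simp
qed

text \<open>Polynomials in these quotients are closed under Wirtinger differentiation by
  \<open>has_wirtinger_q\<close>, and they contain the first derivatives of the logarithm of
  \<open>G [] []\<close>.\<close>

definition q :: "(complex^'n) list \<Rightarrow> (complex^'n) list \<Rightarrow> complex^'n \<Rightarrow> complex" where
  "q I J z = G I J z * inverse (G [] [] z)"

lemma has_wirtinger_q:
  assumes z: "z \<in> U"
  shows "has_wirtinger e (q I J) z (q (e # I) J z - q I J z * q [e] [] z) (q I (e # J) z - q I J z * q [] [e] z)"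
proof -
  have "G [] [] z \<noteq> 0" using G_Nil_Nil_pos[OF z] by auto
  from has_wirtinger_mult[OF has_wirtinger_G[OF z, of e I J] has_wirtinger_inverse[OF has_wirtinger_G[OF z, of e "[]" "[]"] this]]
  show ?thesis by (simp add: q_def[abs_def] power2_eq_square algebra_simps)
qed

lemma has_wirtinger_Ln_pos:
  assumes "has_wirtinger v f z a b" "f z = of_real x" "x > 0"
  shows "has_wirtinger v (\<lambda>w. Ln (f w)) z (inverse (f z) * a) (inverse (f z) * b)"
  by (rule has_wirtinger_compose_field[OF assms(1) has_field_derivative_Ln])
    (use assms in \<open>simp add: complex_nonpos_Reals_iff\<close>)

text \<open>The logarithm splits along \<open>kernel_eq_G\<close>. Taking \<open>Ln\<close> of the
  positive product \<open>\<phi> w * cnj (\<phi> w)\<close> avoids choosing a branch of the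
  logarithm of \<open>\<phi>\<close>.\<close>

lemma has_wirtinger_log_kernel:
  assumes z: "z \<in> U"
  shows "has_wirtinger e (\<lambda>w. complex_of_real (ln (Re (K w w)))) z
    (q [e] [] z + dir_deriv e \<phi> z / \<phi> z) (q [] [e] z + cnj (dir_deriv e \<phi> z / \<phi> z))"
proof (rule has_wirtinger_transform[OF _ U(1) z])
  note h\<phi> = has_wirtinger_holomorphic[OF holomorphic_Cn_subset[OF H_holomorphic[OF \<phi>_in_H] U(3)] z, of e]
  obtain x where x: "x > 0" "G [] [] z = of_real x" using G_Nil_Nil_pos[OF z] by blast
  have \<phi>z: "\<phi> z \<noteq> 0" by (rule U(4)[OF z])
  have y: "\<phi> z * cnj (\<phi> z) = of_real ((cmod (\<phi> z))\<^sup>2)" "(cmod (\<phi> z))\<^sup>2 > 0"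
    using \<phi>z by (simp_all only: complex_norm_square) simp
  from has_wirtinger_add[OF has_wirtinger_Ln_pos[OF has_wirtinger_G[OF z] x(2,1)]
      has_wirtinger_Ln_pos[OF has_wirtinger_mult[OF h\<phi> has_wirtinger_cnj[OF h\<phi>]] y]]
  show "has_wirtinger e (\<lambda>w. Ln (G [] [] w) + Ln (\<phi> w * cnj (\<phi> w))) z
      (q [e] [] z + dir_deriv e \<phi> z / \<phi> z) (q [] [e] z + cnj (dir_deriv e \<phi> z / \<phi> z))"
    using \<phi>z by (simp add: q_def field_simps)
  fix w assume w: "w \<in> U"
  obtain x where x: "x > 0" "G [] [] w = of_real x" using G_Nil_Nil_pos[OF w] by blast
  define y where "y = (cmod (\<phi> w))\<^sup>2"
  have y: "y > 0" "\<phi> w * cnj (\<phi> w) = of_real y"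
    using U(4)[OF w] unfolding y_def by (simp, simp only: complex_norm_square)
  have "Re (K w w) = x * y" unfolding kernel_eq_G[OF w] x y by simp
  then have "complex_of_real (ln (Re (K w w))) = of_real (ln x) + of_real (ln y)"
    using x(1) y(1) by (simp add: ln_mult)
  then show "Ln (G [] [] w) + Ln (\<phi> w * cnj (\<phi> w)) = complex_of_real (ln (Re (K w w)))"
    unfolding x(2) y(2) by (simp add: Ln_of_real x(1) y(1))
qed

abbreviation "ax j \<equiv> axis j (1::complex)"
abbreviation "g \<equiv> bergman_metric \<Omega> \<mu>"

lemma metric_eq_q:
  assumes z: "z \<in> U"
  shows "g z $ i $ j = q [ax i] [ax j] z - q [] [ax j] z * q [ax i] [] z"
proof -
  let ?F = "\<lambda>w. complex_of_real (ln (Re (K w w)))"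
  have \<phi>: "holomorphic_Cn \<phi> U" by (rule holomorphic_Cn_subset[OF H_holomorphic[OF \<phi>_in_H] U(3)])
  \<comment> \<open>The contribution of \<open>\<phi>\<close> to the antiholomorphic derivative is
    the conjugate of this holomorphic function. The next holomorphic derivative annihilates it,
    whence the term \<open>cnj 0\<close>.\<close>
  have "holomorphic_Cn (\<lambda>w. dir_deriv (ax j) \<phi> w / \<phi> w) U"
    by (rule holomorphic_Cn_divide[OF holomorphic_Cn_dir_deriv[OF \<phi> U(1)] \<phi> U(4)])
  from has_wirtinger_add[OF has_wirtinger_q[OF z, of "ax i" "[]" "[ax j]"]
      has_wirtinger_cnj[OF has_wirtinger_holomorphic[OF this z, of "ax i"]]]
  have "has_wirtinger (ax i) (\<lambda>w. partial_zbar j ?F w) z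
      (q [ax i] [ax j] z - q [] [ax j] z * q [ax i] [] z + cnj 0)
      (q [] [ax i, ax j] z - q [] [ax j] z * q [] [ax i] z + cnj (dir_deriv (ax i) (\<lambda>w. dir_deriv (ax j) \<phi> w / \<phi> w) z))"
    by (rule has_wirtinger_transform[OF _ U(1) z])
      (rule partial_zbar_wirtinger[OF has_wirtinger_log_kernel, symmetric])
  from partial_z_wirtinger[OF this] show ?thesis by (simp add: bergman_metric_def)
qed

text \<open>The product rule for \<open>metric_eq_q\<close>, left unsimplified: at \<open>p\<close>
  every factor with exactly one empty list vanishes, so most terms disappear there.\<close>

lemma has_wirtinger_metric:
  assumes z: "z \<in> U"
  shows "has_wirtinger e (\<lambda>w. g w $ i $ j) z
    (q [e, ax i] [ax j] z - q [ax i] [ax j] z * q [e] [] z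
      - (q [] [ax j] z * (q [e, ax i] [] z - q [ax i] [] z * q [e] [] z)
         + (q [e] [ax j] z - q [] [ax j] z * q [e] [] z) * q [ax i] [] z))
    (q [ax i] [e, ax j] z - q [ax i] [ax j] z * q [] [e] z
      - (q [] [ax j] z * (q [ax i] [e] z - q [ax i] [] z * q [] [e] z)
         + (q [] [e, ax j] z - q [] [ax j] z * q [] [e] z) * q [ax i] [] z))"
  by (rule has_wirtinger_transform[OF _ U(1) z metric_eq_q[symmetric]])
    (intro has_wirtinger_diff has_wirtinger_mult has_wirtinger_q z)

lemma q_p: "q I J p = G I J p"
  by (simp add: q_def G_Nil_left)

lemma metric_p: "g p $ i $ j = G [ax i] [ax j] p"
  by (simp add: metric_eq_q[OF U(2)] q_p G_Nil_left G_Nil_right)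

lemma curvature_tensor_p:
  "curvature_tensor g p i j k l =
     - (G [ax k, ax i] [ax l, ax j] p - G [ax i] [ax j] p * G [ax k] [ax l] p - G [ax i] [ax l] p * G [ax k] [ax j] p)
     + (\<Sum>\<alpha>\<in>UNIV. \<Sum>\<beta>\<in>UNIV. matrix_inv (g p) $ \<beta> $ \<alpha> * G [ax k, ax i] [ax \<beta>] p * G [ax \<alpha>] [ax l, ax j] p)"
proof -
  have 1: "partial_z k (\<lambda>z. g z $ i $ \<beta>) p = G [ax k, ax i] [ax \<beta>] p" for \<beta>
    by (subst partial_z_wirtinger[OF has_wirtinger_metric[OF U(2)]]) (simp add: q_p G_Nil_left G_Nil_right)
  have 2: "partial_zbar l (\<lambda>z. g z $ \<alpha> $ j) p = G [ax \<alpha>] [ax l, ax j] p" for \<alpha>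
    by (subst partial_zbar_wirtinger[OF has_wirtinger_metric[OF U(2)]]) (simp add: q_p G_Nil_left G_Nil_right)
  \<comment> \<open>The outer derivative needs the inner one on a neighbourhood of \<open>p\<close>.
    Terms that vanish at \<open>p\<close> must be kept until they have been differentiated.\<close>
  define f where "f z = q [ax i] [ax l, ax j] z - q [ax i] [ax j] z * q [] [ax l] z
      - (q [] [ax j] z * (q [ax i] [ax l] z - q [ax i] [] z * q [] [ax l] z)
         + (q [] [ax l, ax j] z - q [] [ax j] z * q [] [ax l] z) * q [ax i] [] z)" for z
  have f: "f z = partial_zbar l (\<lambda>z. g z $ i $ j) z" if "z \<in> U" for z
    unfolding f_def by (rule partial_zbar_wirtinger[OF has_wirtinger_metric[OF that], symmetric])
  have "partial_z k (partial_zbar l (\<lambda>z. g z $ i $ j)) p =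
      G [ax k, ax i] [ax l, ax j] p - G [ax i] [ax j] p * G [ax k] [ax l] p - G [ax i] [ax l] p * G [ax k] [ax j] p"
    by (rule trans[OF partial_z_wirtinger[OF has_wirtinger_transform[OF _ U(1,2) f]]], unfold f_def[abs_def],
        (rule has_wirtinger_diff has_wirtinger_add has_wirtinger_mult has_wirtinger_q U(2))+)
      (simp_all add: q_p G_Nil_left G_Nil_right)
  then show ?thesis unfolding curvature_tensor_def 1 2 by simp
qed

section \<open>Contraction of the curvature tensor with two vectors\<close>

lemma D_commute: "u \<in> H \<Longrightarrow> D [v, w] u p = D [w, v] u p"
  unfolding D.simps(2) by (rule dir_deriv_commute[OF holomorphic_D U(1,2)])

lemma D_sum1: "u \<in> H \<Longrightarrow> D [X] u p = (\<Sum>i\<in>UNIV. X $ i * D [ax i] u p)"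
  unfolding D.simps(2) by (rule dir_deriv_eq_sum_axis[OF holomorphic_D U(2)])

text \<open>The expansion along the axes applies to the outermost direction; symmetry of second
  derivatives brings each direction outermost in turn.\<close>

lemma D_sum2: "u \<in> H \<Longrightarrow> D [Y, X] u p = (\<Sum>i\<in>UNIV. \<Sum>k\<in>UNIV. X $ i * Y $ k * D [ax k, ax i] u p)"
proof -
  assume u: "u \<in> H"
  have s: "D [v, w] u p = (\<Sum>i\<in>UNIV. v $ i * D [ax i, w] u p)" for v w
    unfolding D.simps(2) by (rule dir_deriv_eq_sum_axis[OF holomorphic_D[OF u, of "[w]", unfolded D.simps(2)] U(2)])
  have "D [ax i, Y] u p = (\<Sum>k\<in>UNIV. Y $ k * D [ax k, ax i] u p)" for i
    using D_commute[OF u, of "ax i" Y] s[of Y "ax i"] by (rule trans)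
  then have "D [Y, X] u p = (\<Sum>i\<in>UNIV. X $ i * (\<Sum>k\<in>UNIV. Y $ k * D [ax k, ax i] u p))"
    using D_commute[OF u, of Y X] s[of X Y] by presburger
  then show ?thesis by (simp add: sum_distrib_left mult.assoc)
qed

lemma G_sum1_left: "G [X] J p = (\<Sum>i\<in>UNIV. X $ i * G [ax i] J p)"
  unfolding G_def by (rule D_sum1[OF rD_in_H[OF U(2)]])

lemma G_sum2_left: "G [Y, X] J p = (\<Sum>i\<in>UNIV. \<Sum>k\<in>UNIV. X $ i * Y $ k * G [ax k, ax i] J p)"
  unfolding G_def by (rule D_sum2[OF rD_in_H[OF U(2)]])

lemma G_sum1_right: "G I [X] p = (\<Sum>i\<in>UNIV. cnj (X $ i) * G I [ax i] p)"
  unfolding G_commute[OF U(2), of I] by (subst G_sum1_left) simp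

lemma G_sum2_right: "G I [Y, X] p = (\<Sum>i\<in>UNIV. \<Sum>k\<in>UNIV. cnj (X $ i) * cnj (Y $ k) * G I [ax k, ax i] p)"
  unfolding G_commute[OF U(2), of I] by (subst G_sum2_left) simp

lemma metric_inner_p: "metric_inner (g p) X Y = G [X] [Y] p"
  unfolding metric_inner_def metric_p G_sum1_left[of X]
  unfolding G_sum1_right[of _ Y]
  by (simp add: sum_distrib_left mult_ac)

lemma curvature_contraction:
  "(\<Sum>i\<in>UNIV. \<Sum>j\<in>UNIV. \<Sum>k\<in>UNIV. \<Sum>l\<in>UNIV.
      curvature_tensor g p i j k l * X $ i * cnj (X $ j) * Y $ k * cnj (Y $ l)) =
    - G [Y, X] [Y, X] p + G [X] [X] p * G [Y] [Y] p + G [X] [Y] p * G [Y] [X] p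
    + (\<Sum>\<alpha>\<in>UNIV. \<Sum>\<beta>\<in>UNIV. matrix_inv (g p) $ \<beta> $ \<alpha> * G [Y, X] [ax \<beta>] p * G [ax \<alpha>] [Y, X] p)"
proof -
  \<comment> \<open>The contraction is a linear functional on four-index arrays. It factors on
    products, and \<open>prod1\<close>, \<open>prod2\<close>, \<open>prod3\<close> treat the three
    pairings of the indices that occur in \<open>curvature_tensor_p\<close>.\<close>
  define S where "S f = (\<Sum>i\<in>UNIV. \<Sum>j\<in>UNIV. \<Sum>k\<in>UNIV. \<Sum>l\<in>UNIV.
      f i j k l * (X $ i * cnj (X $ j) * (Y $ k * cnj (Y $ l))))" for f :: "'n \<Rightarrow> 'n \<Rightarrow> 'n \<Rightarrow> 'n \<Rightarrow> complex"
  have add: "S (\<lambda>i j k l. f i j k l + h i j k l) = S f + S h" for f h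
    by (simp add: S_def distrib_right sum.distrib)
  have minus: "S (\<lambda>i j k l. - f i j k l) = - S f" for f
    by (simp add: S_def sum_negf)
  have cmul: "S (\<lambda>i j k l. c * f i j k l) = c * S f" for f c
    by (simp add: S_def sum_distrib_left mult.assoc)
  have sum: "S (\<lambda>i j k l. \<Sum>\<alpha>\<in>UNIV. h \<alpha> i j k l) = (\<Sum>\<alpha>\<in>UNIV. S (h \<alpha>))" for h :: "'n \<Rightarrow> _"
  proof -
    have "S (\<lambda>i j k l. \<Sum>\<alpha>\<in>A. h \<alpha> i j k l) = (\<Sum>\<alpha>\<in>A. S (h \<alpha>))" if "finite A" for A
      using that by (induction A) (simp_all add: add, simp add: S_def)
    then show ?thesis by simp
  qed
  have prod1: "S (\<lambda>i j k l. a i j * b k l) =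
      (\<Sum>i\<in>UNIV. \<Sum>j\<in>UNIV. X $ i * cnj (X $ j) * a i j) * (\<Sum>k\<in>UNIV. \<Sum>l\<in>UNIV. Y $ k * cnj (Y $ l) * b k l)" for a b
    unfolding S_def sum_distrib_right unfolding sum_distrib_left by (simp add: mult_ac)
  have prod2: "S (\<lambda>i j k l. a i l * b k j) =
      (\<Sum>i\<in>UNIV. \<Sum>l\<in>UNIV. X $ i * cnj (Y $ l) * a i l) * (\<Sum>k\<in>UNIV. \<Sum>j\<in>UNIV. Y $ k * cnj (X $ j) * b k j)" for a b
  proof -
    have "S (\<lambda>i j k l. a i l * b k j) = (\<Sum>i\<in>UNIV. \<Sum>l\<in>UNIV. \<Sum>k\<in>UNIV. \<Sum>j\<in>UNIV.
        a i l * b k j * (X $ i * cnj (X $ j) * (Y $ k * cnj (Y $ l))))"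
      unfolding S_def
      by (subst (2) sum.swap, subst (3) sum.swap, subst (2) sum.swap) (rule refl)
    also have "\<dots> = (\<Sum>i\<in>UNIV. \<Sum>l\<in>UNIV. X $ i * cnj (Y $ l) * a i l) * (\<Sum>k\<in>UNIV. \<Sum>j\<in>UNIV. Y $ k * cnj (X $ j) * b k j)"
      unfolding sum_distrib_right unfolding sum_distrib_left by (simp add: mult_ac)
    finally show ?thesis .
  qed
  have prod3: "S (\<lambda>i j k l. a k i * b l j) =
      (\<Sum>i\<in>UNIV. \<Sum>k\<in>UNIV. X $ i * Y $ k * a k i) * (\<Sum>j\<in>UNIV. \<Sum>l\<in>UNIV. cnj (X $ j) * cnj (Y $ l) * b l j)" for a b
  proof -
    have "S (\<lambda>i j k l. a k i * b l j) = (\<Sum>i\<in>UNIV. \<Sum>k\<in>UNIV. \<Sum>j\<in>UNIV. \<Sum>l\<in>UNIV.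
        a k i * b l j * (X $ i * cnj (X $ j) * (Y $ k * cnj (Y $ l))))"
      unfolding S_def by (subst (2) sum.swap) (rule refl)
    also have "\<dots> = (\<Sum>i\<in>UNIV. \<Sum>k\<in>UNIV. X $ i * Y $ k * a k i) * (\<Sum>j\<in>UNIV. \<Sum>l\<in>UNIV. cnj (X $ j) * cnj (Y $ l) * b l j)"
      unfolding sum_distrib_right unfolding sum_distrib_left by (simp add: mult_ac)
    finally show ?thesis .
  qed
  have quart: "S (\<lambda>i j k l. G [ax k, ax i] [ax l, ax j] p) = G [Y, X] [Y, X] p"
  proof -
    have "S (\<lambda>i j k l. G [ax k, ax i] [ax l, ax j] p) = (\<Sum>i\<in>UNIV. \<Sum>k\<in>UNIV. \<Sum>j\<in>UNIV. \<Sum>l\<in>UNIV.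
        G [ax k, ax i] [ax l, ax j] p * (X $ i * cnj (X $ j) * (Y $ k * cnj (Y $ l))))"
      unfolding S_def by (subst (2) sum.swap) (rule refl)
    also have "\<dots> = G [Y, X] [Y, X] p"
      unfolding G_sum2_left[of Y X "[Y, X]"] unfolding G_sum2_right[of _ Y X] sum_distrib_left
      by (simp add: mult_ac)
    finally show ?thesis .
  qed
  have pair: "(\<Sum>i\<in>UNIV. \<Sum>j\<in>UNIV. V $ i * cnj (W $ j) * G [ax i] [ax j] p) = G [V] [W] p" for V W
    unfolding G_sum1_left[of V] unfolding G_sum1_right[of _ W] by (simp add: sum_distrib_left mult_ac)
  have "(\<Sum>i\<in>UNIV. \<Sum>j\<in>UNIV. \<Sum>k\<in>UNIV. \<Sum>l\<in>UNIV.
      curvature_tensor g p i j k l * X $ i * cnj (X $ j) * Y $ k * cnj (Y $ l)) = S (curvature_tensor g p)"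
    by (simp add: S_def mult_ac)
  also have "\<dots> = S (\<lambda>i j k l. - G [ax k, ax i] [ax l, ax j] p + G [ax i] [ax j] p * G [ax k] [ax l] p
      + G [ax i] [ax l] p * G [ax k] [ax j] p
      + (\<Sum>\<alpha>\<in>UNIV. \<Sum>\<beta>\<in>UNIV. matrix_inv (g p) $ \<beta> $ \<alpha> * (G [ax k, ax i] [ax \<beta>] p * G [ax \<alpha>] [ax l, ax j] p)))"
    by (rule arg_cong[where f = S]) (simp add: fun_eq_iff curvature_tensor_p mult.assoc)
  also have "\<dots> = - G [Y, X] [Y, X] p + G [X] [X] p * G [Y] [Y] p + G [X] [Y] p * G [Y] [X] p
    + (\<Sum>\<alpha>\<in>UNIV. \<Sum>\<beta>\<in>UNIV. matrix_inv (g p) $ \<beta> $ \<alpha> * (G [Y, X] [ax \<beta>] p * G [ax \<alpha>] [Y, X] p))"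
    unfolding add minus sum cmul quart prod1 prod2 prod3 pair
    unfolding G_sum2_left[of Y X, symmetric] G_sum2_right[of _ Y X, symmetric] ..
  finally show ?thesis by (simp add: mult.assoc)
qed

end

section \<open>Minimum integrals\<close>

lemma partial_dir_holomorphic:
  assumes "holomorphic_Cn u S" "z \<in> S"
  shows "partial_dir X u z = dir_deriv X u z"
proof -
  have "partial_z j u z = dir_deriv (axis j 1) u z" for j
    by (rule partial_z_wirtinger[OF has_wirtinger_holomorphic[OF assms]])
  then show ?thesis unfolding partial_dir_def dir_deriv_eq_sum_axis[OF assms, of X] by simp
qed

lemma partial_dir_cong:
  assumes u: "holomorphic_Cn u S" and S: "open S" "z \<in> S" and eq: "\<And>w. w \<in> S \<Longrightarrow> u w = v w"
  shows "partial_dir X v z = partial_dir X u z"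
proof -
  have "partial_dir X v z = dir_deriv X v z"
    by (rule partial_dir_holomorphic[OF holomorphic_Cn_transform[OF u S(1) eq] S(2)])
  also have "\<dots> = dir_deriv X u z" by (rule dir_deriv_cong[OF u S eq])
  finally show ?thesis by (simp add: partial_dir_holomorphic[OF u S(2)])
qed

lemma partial_dir_partial_dir:
  assumes u: "holomorphic_Cn u S" and S: "open S" "z \<in> S"
  shows "partial_dir X (partial_dir Y u) z = dir_deriv X (dir_deriv Y u) z"
proof -
  have h: "holomorphic_Cn (dir_deriv Y u) S" by (rule holomorphic_Cn_dir_deriv[OF u S(1)])
  \<comment> \<open>The two inner derivatives are known to agree on \<open>S\<close>, and agreement
    on an open set suffices for the outer one.\<close>
  have "partial_dir X (partial_dir Y u) z = partial_dir X (dir_deriv Y u) z"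
  proof (rule partial_dir_cong[OF h S])
    show "dir_deriv Y u w = partial_dir Y u w" if "w \<in> S" for w
      by (rule partial_dir_holomorphic[OF u that, symmetric])
  qed
  also have "\<dots> = dir_deriv X (dir_deriv Y u) z" by (rule partial_dir_holomorphic[OF h S(2)])
  finally show ?thesis .
qed

text \<open>The conjugate on \<open>X\<close> makes \<open>lin_form X X\<close> positive for
  \<open>X \<noteq> 0\<close>, while the form stays complex linear in \<open>v\<close>. Such forms
  and their products are the test functions for non-degeneracy.\<close>

definition lin_form :: "complex^'n \<Rightarrow> complex^'n \<Rightarrow> complex" where
  "lin_form X v = (\<Sum>j\<in>UNIV. cnj (X $ j) * v $ j)"

lemma lin_form_self: "lin_form X X = of_real ((norm X)\<^sup>2)"
proof -
  have "(norm X)\<^sup>2 = (\<Sum>j\<in>UNIV. (cmod (X $ j))\<^sup>2)"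
    by (simp add: norm_vec_def L2_set_def sum_nonneg)
  then show ?thesis
    unfolding lin_form_def by (simp only: of_real_sum complex_norm_square) (simp add: mult.commute)
qed

lemma lin_form_commute: "lin_form X Y = cnj (lin_form Y X)"
  by (simp add: lin_form_def mult.commute)

lemma
  fixes a :: "complex^'n"
  shows holomorphic_Cn_lin_form: "holomorphic_Cn (\<lambda>z. lin_form X (z - a)) S"
    and dir_deriv_lin_form: "dir_deriv v (\<lambda>z. lin_form X (z - a)) z = lin_form X v"
proof -
  have bl: "bounded_linear (lin_form X)"
    unfolding lin_form_def[abs_def]
    by (intro bounded_linear_sum bounded_linear_const_mult bounded_linear_vec_nth)
  have D: "((\<lambda>z. lin_form X (z - a)) has_derivative lin_form X) (at z)" for z
    by (rule bounded_linear.has_derivative[OF bl, of "\<lambda>z. z - a" "\<lambda>z. z", simplified])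
      (auto intro!: derivative_eq_intros)
  show "holomorphic_Cn (\<lambda>z. lin_form X (z - a)) S"
    by (rule holomorphic_CnI, rule D) (simp add: lin_form_def sum_distrib_left mult_ac)
  show "dir_deriv v (\<lambda>z. lin_form X (z - a)) z = lin_form X v" by (rule dir_deriv_eqI[OF D])
qed

context weighted_domain
begin

lemma entire_in_H:
  assumes u: "holomorphic_Cn u UNIV"
  shows "u \<in> H"
proof (rule H_bounded)
  show "holomorphic_Cn u \<Omega>" by (rule holomorphic_Cn_subset[OF u]) simp
  have "compact (u ` closure \<Omega>)"
    by (intro compact_continuous_image continuous_on_subset[OF holomorphic_Cn_continuous_on[OF u]])
      (simp_all add: bounded_domain)
  then have "bounded (u ` closure \<Omega>)" by (rule compact_imp_bounded)
  then show "bounded (u ` \<Omega>)" by (rule bounded_subset) (intro image_mono closure_subset)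
qed

text \<open>Common pattern of the three extremal problems: the constraint prescribes the inner
  product with \<open>a\<close>, Cauchy-Schwarz gives the lower bound, and the multiple of
  \<open>a\<close> with that inner product attains it.\<close>

lemma Inf_norm_affine:
  assumes a: "a \<in> H" "N a \<noteq> 0"
    and P: "\<And>u. u \<in> H \<Longrightarrow> P u \<Longrightarrow> ip u a = c"
    and min: "P (\<lambda>z. (c / of_real ((N a)\<^sup>2)) * a z)"
  shows "Inf {(N u)\<^sup>2 | u. u \<in> H \<and> P u} = (cmod c)\<^sup>2 / (N a)\<^sup>2"
proof (rule cInf_eq_minimum)
  let ?m = "\<lambda>z. (c / of_real ((N a)\<^sup>2)) * a z"
  have Na: "(N a)\<^sup>2 > 0" using a(2) by simp
  have "(N ?m)\<^sup>2 = (cmod c)\<^sup>2 / (N a)\<^sup>2"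
  proof -
    have "(x / \<bar>d\<bar>)\<^sup>2 * d = x\<^sup>2 / d" if "d > 0" for x d :: real
      using that by (simp add: power2_eq_square)
    from this[OF Na] show ?thesis unfolding N_cmult norm_divide norm_of_real .
  qed
  from this[symmetric] show "(cmod c)\<^sup>2 / (N a)\<^sup>2 \<in> {(N u)\<^sup>2 | u. u \<in> H \<and> P u}"
    by (intro CollectI exI[of _ ?m] conjI H_cmult[OF a(1)] min)
  fix x assume "x \<in> {(N u)\<^sup>2 | u. u \<in> H \<and> P u}"
  then obtain u where u: "x = (N u)\<^sup>2" "u \<in> H" "P u" by blast
  have "(cmod c)\<^sup>2 \<le> (N u)\<^sup>2 * (N a)\<^sup>2"
    using Cauchy_Schwarz_ip[OF u(2) a(1)] P[OF u(2,3)] by simp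
  then show "(cmod c)\<^sup>2 / (N a)\<^sup>2 \<le> x" using Na u(1) by (simp add: pos_divide_le_eq)
qed

end

section \<open>Non-degeneracy and the orthogonal component\<close>

context weighted_domain_at
begin

lemma holomorphic_quotient: "u \<in> H \<Longrightarrow> holomorphic_Cn (\<lambda>z. u z / \<phi> z) U"
  using holomorphic_D[of u "[]"] by simp

lemma \<phi>_holomorphic: "holomorphic_Cn \<phi> U"
  by (rule holomorphic_Cn_subset[OF H_holomorphic[OF \<phi>_in_H] U(3)])

lemma dir_deriv_eq_D:
  assumes u: "u \<in> H" and z: "z \<in> U"
  shows "dir_deriv v u z = \<phi> z * D [v] u z + dir_deriv v \<phi> z * D [] u z"
proof -
  note h = \<phi>_holomorphic holomorphic_quotient[OF u]
  have "dir_deriv v u z = dir_deriv v (\<lambda>z. \<phi> z * (u z / \<phi> z)) z"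
    by (rule dir_deriv_cong[OF holomorphic_Cn_mult[OF h] U(1) z]) (simp add: U(4))
  then show ?thesis using dir_deriv_mult[OF h z, of v] by simp
qed

text \<open>Leibniz rule for \<open>u = \<phi> * (u / \<phi>)\<close>: terms with a lower derivative
  of \<open>u / \<phi>\<close> vanish at \<open>p\<close>, and the remaining factor is
  \<open>\<phi> p\<close>.\<close>

lemma dir_deriv_dir_deriv_eq_D:
  assumes u: "u \<in> H" and 0: "D [] u p = 0" "\<And>v. D [v] u p = 0"
  shows "dir_deriv X (dir_deriv Y u) p = of_real (sqrt \<kappa>) * D [Y, X] u p"
proof -
  note h = holomorphic_Cn_mult[OF \<phi>_holomorphic holomorphic_D[OF u, of "[Y]"]]
    holomorphic_Cn_mult[OF holomorphic_Cn_dir_deriv[OF \<phi>_holomorphic U(1)] holomorphic_D[OF u, of "[]"], of Y]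
  have "dir_deriv X (dir_deriv Y u) p = dir_deriv X (\<lambda>z. \<phi> z * D [Y] u z + dir_deriv Y \<phi> z * D [] u z) p"
    by (rule dir_deriv_cong[OF holomorphic_Cn_add[OF h] U(1,2)]) (rule dir_deriv_eq_D[OF u, symmetric])
  also have "\<dots> = dir_deriv X (\<lambda>z. \<phi> z * D [Y] u z) p + dir_deriv X (\<lambda>z. dir_deriv Y \<phi> z * D [] u z) p"
    by (rule dir_deriv_add[OF h U(2)])
  also have "dir_deriv X (\<lambda>z. \<phi> z * D [Y] u z) p = \<phi> p * D [X, Y] u p + dir_deriv X \<phi> p * D [Y] u p"
    unfolding D.simps(2)[of X "[Y]"] by (rule dir_deriv_mult[OF \<phi>_holomorphic holomorphic_D[OF u] U(2)])
  also have "dir_deriv X (\<lambda>z. dir_deriv Y \<phi> z * D [] u z) p = dir_deriv Y \<phi> p * D [X] u p + dir_deriv X (dir_deriv Y \<phi>) p * D [] u p"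
    unfolding D.simps(2)[of X "[]"]
    by (rule dir_deriv_mult[OF holomorphic_Cn_dir_deriv[OF \<phi>_holomorphic U(1)] holomorphic_D[OF u] U(2)])
  finally show ?thesis unfolding 0 \<phi>_p D_commute[OF u, of X Y] by simp
qed

lemma value_eq_0_iff: "u \<in> H \<Longrightarrow> u p = 0 \<longleftrightarrow> ip u \<phi> = 0"
  using \<kappa>(1) by (simp add: ip_\<phi>)

lemma value_zero_D: "u p = 0 \<Longrightarrow> D [] u p = 0"
  by simp

lemma dir_deriv_eq_D_p:
  assumes "u \<in> H" "u p = 0"
  shows "dir_deriv v u p = of_real (sqrt \<kappa>) * ip u (rD [v] p)"
  using dir_deriv_eq_D[OF assms(1) U(2), of v] assms(2)
  by (simp only: \<phi>_p D_eq_ip[OF U(2) assms(1), of "[v]"]) simp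

abbreviation "b X \<equiv> rD [X] p"

lemma b_in_H: "b X \<in> H" by (rule rD_in_H[OF U(2)])

lemma G_eq_ip: "G I J p = ip (rD J p) (rD I p)"
  unfolding G_def by (rule D_eq_ip[OF U(2) rD_in_H[OF U(2)]])

text \<open>The test function \<open>lin_form X (z - p)\<close> vanishes at \<open>p\<close> and has
  derivative \<open>(norm X)\<^sup>2\<close> in direction \<open>X\<close>, which a representer of
  norm zero would force to be 0.\<close>

lemma N_b:
  assumes "X \<noteq> 0" shows "N (b X) \<noteq> 0"
proof
  assume "N (b X) = 0"
  define u where "u z = lin_form X (z - p)" for z
  have u: "u \<in> H" unfolding u_def[abs_def] by (rule entire_in_H[OF holomorphic_Cn_lin_form])
  have "u p = 0" by (simp add: u_def lin_form_def)
  then have "dir_deriv X u p = of_real (sqrt \<kappa>) * ip u (b X)" by (rule dir_deriv_eq_D_p[OF u])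
  moreover have "ip u (b X) = 0" using cmod_ip_le[OF u b_in_H, of X] \<open>N (b X) = 0\<close> by simp
  moreover have "dir_deriv X u p = of_real ((norm X)\<^sup>2)"
    unfolding u_def[abs_def] dir_deriv_lin_form by (rule lin_form_self)
  ultimately show False using assms by simp
qed

lemma metric_norm_p: "(metric_norm (g p) X)\<^sup>2 = (N (b X))\<^sup>2"
  by (simp add: metric_norm_def metric_inner_p G_eq_ip ip_self)

text \<open>The metric at \<open>p\<close> is a Gram matrix, definite by \<open>N_b\<close>; so its
  kernel is trivial and \<open>matrix_inv\<close> is a genuine inverse.\<close>

lemma metric_inverse: "(\<Sum>\<alpha>\<in>UNIV. G [ax \<gamma>] [ax \<alpha>] p * matrix_inv (g p) $ \<alpha> $ \<delta>) = (if \<gamma> = \<delta> then 1 else 0)"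
proof -
  have "x = 0" if x: "g p *v x = 0" for x
  proof -
    \<comment> \<open>\<open>metric_inner\<close> conjugates its second argument, so a kernel vector
      is tested through its conjugate.\<close>
    define Z where "Z = (\<chi> i. cnj (x $ i))"
    have "(\<Sum>k\<in>UNIV. g p $ j $ k * x $ k) = 0" for j
      using arg_cong[OF x, of "\<lambda>y. y $ j"] by (simp add: matrix_vector_mult_def)
    then have "metric_inner (g p) Z Z = 0"
      by (simp add: metric_inner_def Z_def mult.assoc mult.left_commute[of _ "cnj _"] flip: sum_distrib_left)
    then have "N (b Z) = 0" by (simp add: metric_inner_p G_eq_ip ip_self)
    then have "Z = 0" using N_b by blast
    then show "x = 0" by (simp add: Z_def vec_eq_iff)
  qed
  then have "\<exists>B. B ** g p = mat 1" unfolding matrix_left_invertible_ker by blast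
  then have "invertible (g p)" by (simp add: invertible_left_inverse)
  then have "\<exists>B. g p ** B = mat 1 \<and> B ** g p = mat 1" by (simp add: invertible_def)
  then have "g p ** matrix_inv (g p) = mat 1" unfolding matrix_inv_def by (rule someI2_ex) blast
  from arg_cong[OF this, of "\<lambda>A. A $ \<gamma> $ \<delta>"] show ?thesis
    by (simp add: matrix_matrix_mult_def mat_def metric_p)
qed

text \<open>The component of the representer of \<open>u \<mapsto> \<partial>\<^sub>Y \<partial>\<^sub>X (u / \<phi>) (p)\<close> orthogonal to the
  representers of the first derivatives.\<close>

definition perp :: "complex^'n \<Rightarrow> complex^'n \<Rightarrow> complex^'n \<Rightarrow> complex" where
  "perp X Y z = rD [Y, X] p z
     - (\<Sum>\<alpha>\<in>UNIV. (\<Sum>\<beta>\<in>UNIV. matrix_inv (g p) $ \<alpha> $ \<beta> * G [ax \<beta>] [Y, X] p) * b (ax \<alpha>) z)"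

lemma perp_sum_in_H: "(\<lambda>z. \<Sum>\<alpha>\<in>UNIV. c \<alpha> * b (ax \<alpha>) z) \<in> H"
  by (intro H_sum H_cmult b_in_H)

lemma perp_in_H: "perp X Y \<in> H"
  unfolding perp_def[abs_def] by (intro H_diff perp_sum_in_H rD_in_H U(2))

lemma ip_perp_left:
  assumes "u \<in> H"
  shows "ip (perp X Y) u = ip (rD [Y, X] p) u
    - (\<Sum>\<alpha>\<in>UNIV. (\<Sum>\<beta>\<in>UNIV. matrix_inv (g p) $ \<alpha> $ \<beta> * G [ax \<beta>] [Y, X] p) * ip (b (ax \<alpha>)) u)"
  unfolding perp_def[abs_def]
  by (simp add: ip_diff_left[OF rD_in_H[OF U(2)] perp_sum_in_H assms] ip_sum_left[OF H_cmult[OF b_in_H] assms] ip_cmult_left)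

text \<open>The coefficients in \<open>perp\<close>, built from the inverse Gram matrix, solve the
  normal equations of the orthogonal projection.\<close>

lemma ip_perp_b_axis: "ip (perp X Y) (b (ax \<gamma>)) = 0"
proof -
  have "(\<Sum>\<alpha>\<in>UNIV. (\<Sum>\<beta>\<in>UNIV. matrix_inv (g p) $ \<alpha> $ \<beta> * G [ax \<beta>] [Y, X] p) * G [ax \<gamma>] [ax \<alpha>] p)
      = (\<Sum>\<beta>\<in>UNIV. (\<Sum>\<alpha>\<in>UNIV. G [ax \<gamma>] [ax \<alpha>] p * matrix_inv (g p) $ \<alpha> $ \<beta>) * G [ax \<beta>] [Y, X] p)"
    unfolding sum_distrib_right by (subst sum.swap) (simp add: mult_ac)
  also have "\<dots> = G [ax \<gamma>] [Y, X] p"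
    unfolding metric_inverse by (simp add: if_distrib[of "\<lambda>x. x * _"] cong: if_cong)
  finally show ?thesis by (simp add: ip_perp_left[OF b_in_H] flip: G_eq_ip)
qed

lemma ip_perp_\<phi>: "ip (perp X Y) \<phi> = 0"
  by (simp add: ip_perp_left[OF \<phi>_in_H] ip_rD_\<phi>)

lemma ip_perp_b: "ip (perp X Y) (b V) = 0"
proof -
  have "ip (perp X Y) (b V) = D [V] (perp X Y) p"
    by (rule D_eq_ip[OF U(2) perp_in_H, symmetric])
  also have "\<dots> = 0"
    unfolding D_sum1[OF perp_in_H, of V] unfolding D_eq_ip[OF U(2) perp_in_H] ip_perp_b_axis by simp
  finally show ?thesis .
qed

text \<open>The part removed from \<open>rD [Y, X] p\<close> is a combination of the
  \<open>b V\<close>, to which \<open>u\<close> is orthogonal. So \<open>perp X Y\<close> still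
  represents the second derivative on the candidates for \<open>min_integral2\<close>.\<close>

lemma ip_perp_right:
  assumes u: "u \<in> H" and "\<And>V. ip u (b V) = 0"
  shows "ip u (perp X Y) = ip u (rD [Y, X] p)"
proof -
  have "cnj (ip u (perp X Y)) = cnj (ip u (rD [Y, X] p))"
    unfolding ip_cnj ip_perp_left[OF u] using assms(2) ip_cnj[of u "b _", symmetric] by simp
  then show ?thesis by simp
qed

lemma ip_perp_rD: "ip (perp X Y) (rD [Y, X] p) = of_real ((N (perp X Y))\<^sup>2)"
  by (simp only: ip_perp_right[OF perp_in_H ip_perp_b, symmetric] ip_self)

text \<open>The subtracted double sum is exactly the inverse-metric term of
  \<open>curvature_contraction\<close>; this is how \<open>perp\<close> enters the
  curvature.\<close>

lemma N_perp: "of_real ((N (perp X Y))\<^sup>2) = G [Y, X] [Y, X] p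
    - (\<Sum>\<alpha>\<in>UNIV. \<Sum>\<beta>\<in>UNIV. matrix_inv (g p) $ \<beta> $ \<alpha> * G [Y, X] [ax \<beta>] p * G [ax \<alpha>] [Y, X] p)"
proof -
  have "(\<Sum>\<alpha>\<in>UNIV. \<Sum>\<beta>\<in>UNIV. matrix_inv (g p) $ \<beta> $ \<alpha> * G [Y, X] [ax \<beta>] p * G [ax \<alpha>] [Y, X] p)
    = (\<Sum>\<alpha>\<in>UNIV. (\<Sum>\<beta>\<in>UNIV. matrix_inv (g p) $ \<alpha> $ \<beta> * G [ax \<beta>] [Y, X] p) * G [Y, X] [ax \<alpha>] p)"
    unfolding sum_distrib_right by (subst sum.swap) (simp add: mult_ac)
  then show ?thesis
    by (simp only: ip_perp_rD[symmetric] ip_perp_left[OF rD_in_H[OF U(2)]] G_eq_ip[symmetric])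
qed

text \<open>The product of the forms for \<open>X\<close> and \<open>Y\<close> vanishes at
  \<open>p\<close> with its first derivatives, while its second derivative there is \<open>(norm
  Y)\<^sup>2 * (norm X)\<^sup>2 + (cmod (lin_form Y X))\<^sup>2\<close>. If \<open>perp X Y\<close>
  had norm zero, this positive number would be 0.\<close>

lemma N_perp_nonzero:
  assumes "X \<noteq> 0" "Y \<noteq> 0"
  shows "N (perp X Y) \<noteq> 0"
proof
  assume N0: "N (perp X Y) = 0"
  define l where "l X z = lin_form X (z - p)" for X z
  have l: "holomorphic_Cn (l X) S" for X S unfolding l_def[abs_def] by (rule holomorphic_Cn_lin_form)
  have ddl: "dir_deriv v (l X) z = lin_form X v" for v X z unfolding l_def[abs_def] by (rule dir_deriv_lin_form)
  have lp: "l X p = 0" for X by (simp add: l_def lin_form_def)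
  define u where "u z = l X z * l Y z" for z
  have u: "u \<in> H" unfolding u_def[abs_def] by (rule entire_in_H[OF holomorphic_Cn_mult[OF l l]])
  have dd1: "dir_deriv v u = (\<lambda>z. lin_form Y v * l X z + lin_form X v * l Y z)" for v
    unfolding u_def[abs_def] by (rule ext) (simp add: dir_deriv_mult[OF l l UNIV_I] ddl mult.commute)
  have dd2: "dir_deriv X (dir_deriv Y u) p = lin_form Y Y * lin_form X X + lin_form X Y * lin_form Y X"
    unfolding dd1 dir_deriv_add[OF holomorphic_Cn_cmult[OF l] holomorphic_Cn_cmult[OF l] UNIV_I]
      dir_deriv_cmult[OF l UNIV_I] ddl ..
  have up: "u p = 0" by (simp add: u_def lp)
  have "of_real (sqrt \<kappa>) * ip u (b v) = 0" for v
    unfolding dir_deriv_eq_D_p[OF u up, symmetric] dd1 lp by simp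
  then have ub: "ip u (b v) = 0" for v using \<kappa>(1) by simp
  have "D [v] u p = 0" for v unfolding D_eq_ip[OF U(2) u] by (rule ub)
  from dir_deriv_dir_deriv_eq_D[OF u value_zero_D[of u, OF up] this]
  have "dir_deriv X (dir_deriv Y u) p = of_real (sqrt \<kappa>) * ip u (perp X Y)"
    unfolding ip_perp_right[OF u ub] D_eq_ip[OF U(2) u, symmetric] .
  moreover have "ip u (perp X Y) = 0" using cmod_ip_le[OF u perp_in_H, of X Y] N0 by simp
  ultimately have "lin_form Y Y * lin_form X X + lin_form X Y * lin_form Y X = 0" using dd2 by simp
  moreover have "lin_form X Y * lin_form Y X = of_real ((cmod (lin_form Y X))\<^sup>2)"
    unfolding lin_form_commute[of X Y] complex_norm_square by simp
  ultimately have "of_real ((norm Y)\<^sup>2 * (norm X)\<^sup>2 + (cmod (lin_form Y X))\<^sup>2) = (0::complex)"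
    by (simp only: lin_form_self of_real_add of_real_mult)
  then have "(norm Y)\<^sup>2 * (norm X)\<^sup>2 + (cmod (lin_form Y X))\<^sup>2 = 0" by (simp only: of_real_eq_0_iff)
  moreover have "(norm Y)\<^sup>2 * (norm X)\<^sup>2 > 0" using assms by simp
  ultimately show False using zero_le_power2[of "cmod (lin_form Y X)"] by linarith
qed

section \<open>Values of the minimum integrals and the curvature formula\<close>

lemma cmod_inverse_sqrt_\<kappa>: "(cmod (1 / of_real (sqrt \<kappa>)))\<^sup>2 = 1 / \<kappa>"
  using \<kappa>(1) by (simp add: norm_divide power_divide)

lemma ip_scaled: "ip v a = of_real ((N a)\<^sup>2) \<Longrightarrow> N a \<noteq> 0 \<Longrightarrow> ip (\<lambda>z. c / of_real ((N a)\<^sup>2) * v z) a = c"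
  unfolding ip_cmult_left by simp

lemma min_integral0_eq: "min_integral0 \<Omega> \<mu> p = 1 / \<kappa>"
proof -
  have N: "N \<phi> \<noteq> 0" using N_\<phi> by auto
  have "min_integral0 \<Omega> \<mu> p = (cmod (1 / of_real (sqrt \<kappa>)))\<^sup>2 / (N \<phi>)\<^sup>2"
    unfolding min_integral0_def
  proof (rule Inf_norm_affine[OF \<phi>_in_H N])
    show "ip u \<phi> = 1 / of_real (sqrt \<kappa>)" if "u \<in> H" "u p = 1" for u
      using that by (simp add: ip_\<phi>)
    show "1 / complex_of_real (sqrt \<kappa>) / complex_of_real ((N \<phi>)\<^sup>2) * \<phi> p = 1"
      unfolding N_\<phi> \<phi>_p using \<kappa>(1) by simp
  qed
  then show ?thesis by (simp add: N_\<phi> cmod_inverse_sqrt_\<kappa>)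
qed

text \<open>For \<open>u\<close> vanishing at \<open>p\<close> the constraint on the derivative
  reads \<open>ip u (b X) = 1 / sqrt \<kappa>\<close>. As \<open>b X\<close> is orthogonal to
  \<open>\<phi>\<close>, its multiples vanish at \<open>p\<close> and one of them is
  extremal.\<close>

lemma min_integral1_eq:
  assumes X: "X \<noteq> 0"
  shows "min_integral1 \<Omega> \<mu> p X = 1 / (\<kappa> * (N (b X))\<^sup>2)"
proof -
  note N = N_b[OF X]
  let ?c = "1 / of_real (sqrt \<kappa>) :: complex"
  let ?m = "\<lambda>z. ?c / of_real ((N (b X))\<^sup>2) * b X z"
  have dir: "partial_dir X u p = of_real (sqrt \<kappa>) * ip u (b X)" if "u \<in> H" "u p = 0" for u
    using partial_dir_holomorphic[OF H_holomorphic[OF that(1)] p_in] dir_deriv_eq_D_p[OF that] by simp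
  have m: "?m \<in> H" by (rule H_cmult[OF b_in_H])
  have "ip ?m \<phi> = 0" by (simp only: ip_cmult_left ip_rD_\<phi>) simp
  then have mp: "?m p = 0" by (simp only: value_eq_0_iff[OF m])
  have "min_integral1 \<Omega> \<mu> p X = (cmod ?c)\<^sup>2 / (N (b X))\<^sup>2"
    unfolding min_integral1_def
  proof (rule Inf_norm_affine[OF b_in_H N])
    show "ip u (b X) = ?c" if "u \<in> H" "u p = 0 \<and> partial_dir X u p = 1" for u
      using dir[of u] that \<kappa>(1) by (simp add: field_simps)
    show "?m p = 0 \<and> partial_dir X ?m p = 1"
      using mp dir[OF m mp] ip_scaled[OF ip_self N, of ?c] \<kappa>(1) by simp
  qed
  then show ?thesis by (simp add: cmod_inverse_sqrt_\<kappa>)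
qed

text \<open>Vanishing value and differential mean orthogonality to \<open>\<phi>\<close> and to all
  \<open>b V\<close>. On that subspace the second derivative is \<open>sqrt \<kappa>\<close> times
  the pairing with \<open>perp X Y\<close>, which itself lies in the subspace.\<close>

lemma min_integral2_eq:
  assumes XY: "X \<noteq> 0" "Y \<noteq> 0"
  shows "min_integral2 \<Omega> \<mu> p X Y = 1 / (\<kappa> * (N (perp X Y))\<^sup>2)"
proof -
  note N = N_perp_nonzero[OF XY]
  let ?a = "perp X Y"
  let ?c = "1 / of_real (sqrt \<kappa>) :: complex"
  let ?m = "\<lambda>z. ?c / of_real ((N ?a)\<^sup>2) * ?a z"
  have dir: "partial_dir X (partial_dir Y u) p = of_real (sqrt \<kappa>) * ip u (rD [Y, X] p)"
    if u: "u \<in> H" "u p = 0" "\<And>V. ip u (b V) = 0" for u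
  proof -
    have "D [v] u p = 0" for v unfolding D_eq_ip[OF U(2) u(1)] by (rule u(3))
    from dir_deriv_dir_deriv_eq_D[OF u(1) value_zero_D[of u, OF u(2)] this]
    show ?thesis
      unfolding partial_dir_partial_dir[OF H_holomorphic[OF u(1)] open_domain p_in] D_eq_ip[OF U(2) u(1)] .
  qed
  have m: "?m \<in> H" by (rule H_cmult[OF perp_in_H])
  have "ip ?m \<phi> = 0" by (simp only: ip_cmult_left ip_perp_\<phi>) simp
  then have mp: "?m p = 0" by (simp only: value_eq_0_iff[OF m])
  have mb: "ip ?m (b V) = 0" for V by (simp only: ip_cmult_left ip_perp_b) simp
  have "min_integral2 \<Omega> \<mu> p X Y = (cmod ?c)\<^sup>2 / (N ?a)\<^sup>2"
    unfolding min_integral2_def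
  proof (rule Inf_norm_affine[OF perp_in_H N])
    fix u assume u: "u \<in> H" and
      P: "u p = 0 \<and> (u has_derivative (\<lambda>_. 0)) (at p) \<and> partial_dir X (partial_dir Y u) p = 1"
    then have up: "u p = 0" by blast
    have "dir_deriv V u p = 0" for V using P dir_deriv_eqI by blast
    then have ub: "ip u (b V) = 0" for V using dir_deriv_eq_D_p[OF u up, of V] \<kappa>(1) by simp
    have "of_real (sqrt \<kappa>) * ip u (rD [Y, X] p) = 1" using dir[OF u up ub] P by simp
    then show "ip u ?a = ?c" unfolding ip_perp_right[OF u ub] using \<kappa>(1) by (simp add: field_simps)
  next
    have "dir_deriv V ?m p = 0" for V unfolding dir_deriv_eq_D_p[OF m mp] mb by simp
    then have "(?m has_derivative (\<lambda>_. 0)) (at p)"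
      using holomorphic_Cn_has_derivative[OF H_holomorphic[OF m] p_in] by simp
    moreover have "partial_dir X (partial_dir Y ?m) p = 1"
      unfolding dir[OF m mp mb] ip_perp_right[OF m mb, symmetric] ip_scaled[OF ip_self N]
      using \<kappa>(1) by simp
    ultimately show "?m p = 0 \<and> (?m has_derivative (\<lambda>_. 0)) (at p) \<and> partial_dir X (partial_dir Y ?m) p = 1"
      using mp by blast
  qed
  then show ?thesis by (simp add: cmod_inverse_sqrt_\<kappa>)
qed

lemma bisectional_curvature_eq:
  assumes XY: "X \<noteq> 0" "Y \<noteq> 0"
  shows "bisectional_curvature g p X Y = complex_of_real
    (2 - (1 - (cmod (metric_inner (g p) X Y))\<^sup>2 / ((metric_norm (g p) X)\<^sup>2 * (metric_norm (g p) Y)\<^sup>2))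
       - min_integral1 \<Omega> \<mu> p X * min_integral1 \<Omega> \<mu> p Y / (min_integral2 \<Omega> \<mu> p X Y * min_integral0 \<Omega> \<mu> p))"
proof -
  define x where "x = (N (b X))\<^sup>2"
  define y where "y = (N (b Y))\<^sup>2"
  define n where "n = (N (perp X Y))\<^sup>2"
  define c where "c = (cmod (G [X] [Y] p))\<^sup>2"
  have pos: "x > 0" "y > 0" "n > 0" "\<kappa> > 0"
    using N_b XY N_perp_nonzero \<kappa>(1) by (simp_all add: x_def y_def n_def)
  have GX: "G [X] [X] p = of_real x" and GY: "G [Y] [Y] p = of_real y"
    by (simp_all only: G_eq_ip ip_self x_def y_def)
  have GXY: "G [X] [Y] p * G [Y] [X] p = of_real c"
    unfolding c_def complex_norm_square G_commute[OF U(2), of "[Y]" "[X]"] ..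
  have "(\<Sum>i\<in>UNIV. \<Sum>j\<in>UNIV. \<Sum>k\<in>UNIV. \<Sum>l\<in>UNIV.
      curvature_tensor g p i j k l * X $ i * cnj (X $ j) * Y $ k * cnj (Y $ l)) = of_real (x * y + c - n)"
    using N_perp[of X Y] unfolding curvature_contraction GX GY GXY n_def[symmetric]
    by (simp add: algebra_simps)
  then have "bisectional_curvature g p X Y = of_real ((x * y + c - n) / (x * y))"
    unfolding bisectional_curvature_def metric_norm_p x_def[symmetric] y_def[symmetric]
    by (simp only: of_real_divide)
  \<comment> \<open>All factors \<open>\<kappa>\<close> cancel in the quotient of the minimum
    integrals, which equals \<open>n / (x * y)\<close>.\<close>
  also have "(x * y + c - n) / (x * y) = 2 - (1 - c / (x * y)) - 1 / (\<kappa> * x) * (1 / (\<kappa> * y)) / (1 / (\<kappa> * n) * (1 / \<kappa>))"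
    using pos by (simp add: field_simps)
  finally show ?thesis
    unfolding metric_norm_p metric_inner_p min_integral0_eq min_integral1_eq[OF XY(1)] min_integral1_eq[OF XY(2)]
      min_integral2_eq[OF XY] x_def[symmetric] y_def[symmetric] n_def[symmetric] c_def[symmetric] .
qed

end

theorem theorem1:
  fixes \<Omega> :: "(complex^'n) set" and \<mu> :: "complex^'n \<Rightarrow> real" and p X Y :: "complex^'n"
  assumes "open \<Omega>" and "connected \<Omega>" and "bounded \<Omega>"
    and "admissible_weight \<Omega> \<mu>" and "integrable (lebesgue_on \<Omega>) \<mu>"
    and "p \<in> \<Omega>" and "X \<noteq> 0" and "Y \<noteq> 0"
  shows "bisectional_curvature (bergman_metric \<Omega> \<mu>) p X Y = complex_of_real
    (2 - (1 - (cmod (metric_inner (bergman_metric \<Omega> \<mu> p) X Y))\<^sup>2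
              / ((metric_norm (bergman_metric \<Omega> \<mu> p) X)\<^sup>2 * (metric_norm (bergman_metric \<Omega> \<mu> p) Y)\<^sup>2))
       - min_integral1 \<Omega> \<mu> p X * min_integral1 \<Omega> \<mu> p Y
         / (min_integral2 \<Omega> \<mu> p X Y * min_integral0 \<Omega> \<mu> p))"
proof -
  interpret weighted_domain_at \<Omega> \<mu> p
    by unfold_locales (use assms in auto)
  show ?thesis by (rule bisectional_curvature_eq[OF assms(7,8)])
qed

end
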